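(* Let $p\in\{53,71,73,89\}$. Let $\alpha$ be the unique integer with $0<\alpha<2p$ and $\alpha\equiv -3^{-1}\pmod{2p}$, and let $\beta=\lfloor 2p/3\rfloor$. Then \[ \sum_{n=0}^{\infty}b_{9}(2pn+\alpha)q^{n}\equiv q^{\beta}\sum_{n=0}^{\infty}b_{9}(2n+1)q^{pn}\pmod 2 . \]
   Context: For an integer $t\ge 2$, a $t$-regular partition of $n$ is a partition of $n$ none of whose parts is divisible by $t$; $b_t(n)$ denotes the number of $t$-regular partitions of $n$ (with $b_t(0)=1$). Equivalently, $\sum_{n\ge0}b_t(n)q^n=f_t/f_1$, where $f_k=\prod_{j\ge1}(1-q^{jk})$. A congruence of power series modulo $2$ means coefficientwise congruence. *)

theory Defs
  imports
    Complex_Main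
    "HOL-Library.Multiset"
    "HOL-Computational_Algebra.Formal_Power_Series"
    "HOL-Number_Theory.Number_Theory"
begin

text \<open>A partition of \<open>n\<close> is encoded as the multiset of its parts.\<close>

definition regular_partitions :: "nat \<Rightarrow> nat \<Rightarrow> nat multiset set" where
  "regular_partitions t n =
     {P. (\<forall>x \<in># P. 0 < x) \<and> \<Sum>\<^sub># P = n \<and> (\<forall>x \<in># P. \<not> t dvd x)}"

definition num_regular_partitions :: "nat \<Rightarrow> nat \<Rightarrow> nat" where
  "num_regular_partitions t n = card (regular_partitions t n)"

definition fps_cong_mod :: "int \<Rightarrow> int fps \<Rightarrow> int fps \<Rightarrow> bool" where
  "fps_cong_mod m F G \<longleftrightarrow> (\<forall>n. [fps_nth F n = fps_nth G n] (mod m))"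

lemma finite_regular_partitions: "finite (regular_partitions t n)"
proof (rule finite_subset)
  show "regular_partitions t n \<subseteq> mset ` {xs. set xs \<subseteq> {..n} \<and> length xs \<le> n}"
  proof
    fix P assume P: "P \<in> regular_partitions t n"
    obtain xs where xs: "P = mset xs" by (metis ex_mset)
    have s: "sum_list xs = n" and pos: "\<forall>x \<in> set xs. 0 < x"
      using P by (simp_all add: regular_partitions_def xs sum_mset_sum_list)
    have "length xs \<le> sum_list xs" using pos by (induction xs) auto
    moreover have "set xs \<subseteq> {..n}" using member_le_sum_list s by fastforce
    ultimately show "P \<in> mset ` {xs. set xs \<subseteq> {..n} \<and> length xs \<le> n}"
      using s xs by blast
  qed
qed (simp add: finite_lists_length_le)

lemma num_regular_partitions_0: "num_regular_partitions t 0 = 1"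
proof -
  have "P = {#}" if "\<forall>x \<in># P. 0 < x" "\<Sum>\<^sub># P = 0" for P :: "nat multiset"
    using that by (cases P) auto
  then have "regular_partitions t 0 = {{#}}"
    by (auto simp: regular_partitions_def)
  then show ?thesis by (simp add: num_regular_partitions_def)
qed

lemma ex1_neg_modular_inverse:
  fixes p :: nat
  assumes "p \<in> {53, 71, 73, 89}"
  shows "\<exists>!a. 0 < a \<and> a < 2 * p \<and>
           [int a = - modular_inverse (2 * int p) 3] (mod (2 * int p))"
proof -
  let ?m = "2 * int p"
  let ?a = "(- modular_inverse ?m 3) mod ?m"
  have m: "1 < ?m" and cop: "coprime 3 ?m"
    using assms by (auto simp: coprime_iff_gcd_eq_1 gcd_non_0_int)
  have "\<not> ?m dvd modular_inverse ?m 3"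
  proof
    assume "?m dvd modular_inverse ?m 3"
    then have "?m dvd 1"
      by (rule coprime_common_divisor[OF coprime_modular_inverse[OF cop]]) simp
    with m show False using zdvd_imp_le[of ?m 1] by linarith
  qed
  then have "?a \<noteq> 0" by (metis dvd_minus_iff dvd_eq_mod_eq_0)
  moreover have bounds: "0 \<le> ?a" "?a < ?m"
    using m by (simp_all only: pos_mod_sign pos_mod_bound zero_less_one less_trans)
  ultimately have pos: "0 < ?a" by linarith
  show ?thesis
  proof (rule ex1I[of _ "nat ?a"], intro conjI)
    show "0 < nat ?a" using pos by linarith
    show "nat ?a < 2 * p" using bounds by linarith
    show "[int (nat ?a) = - modular_inverse ?m 3] (mod ?m)"
      using bounds by (simp add: cong_def)
  next
    fix a :: nat
    assume a: "0 < a \<and> a < 2 * p \<and> [int a = - modular_inverse ?m 3] (mod ?m)"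
    then have "int a mod ?m = ?a" by (simp add: cong_def)
    moreover have "int a mod ?m = int a" using a by (intro mod_pos_pos_trivial) linarith+
    ultimately show "a = nat ?a" by linarith
  qed
qed

end

theory Submission
  imports Defs "HOL-Library.Z2" "HOL-Library.Disjoint_Sets" "HOL-Computational_Algebra.Computational_Algebra"
begin

text \<open>Work with power series over the field with two elements, where \<open>F(q)\<^sup>2 = F(q\<^sup>2)\<close>, and write
  \<open>f\<^sub>k\<close> for the Euler product in \<open>q\<^sup>k\<close>. Theta series and the Jacobi triple product give
  \<open>f\<^sub>3 \<Sum>n. b\<^sub>9(2n+1) q\<^sup>n = f\<^sub>1 f\<^sub>9\<^sup>2\<close>. Replacing \<open>q\<close> by its cube and multiplying by \<open>q\<^sup>2\<close> turns the
  quotient \<open>f\<^sub>1 f\<^sub>9\<^sup>2 / f\<^sub>3\<close> into a reduction of an Eisenstein series of weight 1: by Kronecker's identity for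
  products of theta functions and the 3-dissection of the pentagonal series, \<open>b\<^sub>9(2n+1)\<close> has the parity
  of the number of factorisations \<open>3n + 2 = u v\<close> over the integers with
  \<open>(u, v) mod 9 \<in> {(2,1), (5,1), (4,2)}\<close>. If \<open>p \<equiv> \<plusminus>1 (mod 9)\<close> is prime and \<open>\<pi> = \<plusminus>p \<equiv> 1 (mod 9)\<close>, moving
  the full power of \<open>\<pi>\<close> from one factor to the other is an involution on the factorisations of
  \<open>p N\<close> in which \<open>p\<close> does not divide both factors; the remaining ones correspond to the factorisations of \<open>N / p\<close>.\<close>

section \<open>Ring arithmetic in the field with two elements\<close>

declare add_bit_eq_xor [simp del] mult_bit_eq_and [simp del]

lemma bit_add_self [simp]: "(x::bit) + x = 0"
  by (cases x) (simp_all add: add_bit_eq_xor)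

lemma bit_add_eq_0_iff: "(x::bit) + y = 0 \<longleftrightarrow> x = y"
  by (cases x; cases y) (simp_all add: add_bit_eq_xor)

lemma of_nat_bit_eq_iff: "(of_nat m :: bit) = of_nat n \<longleftrightarrow> even m = even n"
proof -
  have *: "(of_nat k :: bit) = (if even k then 0 else 1)" for k
    by (induction k) (simp_all add: add_bit_eq_xor)
  show ?thesis by (simp add: *)
qed

lemma fps_bit_add_self: "(F::bit fps) + F = 0"
  by (rule fps_ext) (simp only: fps_add_nth bit_add_self fps_zero_nth)

lemma fps_bit_2 [simp]: "(2::bit fps) = 0"
  using fps_bit_add_self[of 1] by simp

subsection \<open>Generating functions modulo 2 of weighted sets\<close>

text \<open>The coefficients are parities of cardinalities. Weights are integers because theta
  exponents and products of signed factors live there; a weight attained infinitely often would get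
  the default sum 0, which \<open>admissible\<close> rules out.\<close>

definition gf :: "'a set \<Rightarrow> ('a \<Rightarrow> int) \<Rightarrow> bit fps" where
  "gf I w = Abs_fps (\<lambda>n. \<Sum>i | i \<in> I \<and> w i = int n. 1)"

definition admissible :: "'a set \<Rightarrow> ('a \<Rightarrow> int) \<Rightarrow> bool" where
  "admissible I w \<longleftrightarrow> (\<forall>i\<in>I. 0 \<le> w i) \<and> (\<forall>n. finite {i \<in> I. w i \<le> n})"

lemma gf_nth: "fps_nth (gf I w) n = (\<Sum>i | i \<in> I \<and> w i = int n. 1)"
  by (simp add: gf_def)

lemma admissible_finite: "admissible I w \<Longrightarrow> finite {i \<in> I. w i = n}"
  by (rule finite_subset[of _ "{i \<in> I. w i \<le> n}"]) (auto simp: admissible_def)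

lemma admissible_nonneg: "admissible I w \<Longrightarrow> i \<in> I \<Longrightarrow> 0 \<le> w i"
  by (simp add: admissible_def)

lemma admissible_subset:
  assumes "admissible I w" "J \<subseteq> I"
  shows "admissible J w"
proof -
  have "{i \<in> J. w i \<le> n} \<subseteq> {i \<in> I. w i \<le> n}" for n using assms(2) by auto
  then show ?thesis
    using assms unfolding admissible_def by (meson finite_subset subsetD)
qed

lemma admissible_Un: "admissible I w \<Longrightarrow> admissible J w \<Longrightarrow> admissible (I \<union> J) w"
proof -
  assume *: "admissible I w" "admissible J w"
  have "{i \<in> I \<union> J. w i \<le> n} = {i \<in> I. w i \<le> n} \<union> {i \<in> J. w i \<le> n}" for n by auto
  with * show ?thesis by (auto simp only: admissible_def finite_Un)
qed

lemma admissible_Times: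
  assumes "admissible I w" "admissible J v"
  shows "admissible (I \<times> J) (\<lambda>(i, j). w i + v j)"
proof -
  have "finite {x \<in> I \<times> J. (case x of (i, j) \<Rightarrow> w i + v j) \<le> n}" for n
  proof (rule finite_subset)
    show "{x \<in> I \<times> J. (case x of (i, j) \<Rightarrow> w i + v j) \<le> n}
            \<subseteq> {i \<in> I. w i \<le> n} \<times> {j \<in> J. v j \<le> n}"
    proof
      fix x assume "x \<in> {x \<in> I \<times> J. (case x of (i, j) \<Rightarrow> w i + v j) \<le> n}"
      then obtain i j where x: "x = (i, j)" "i \<in> I" "j \<in> J" "w i + v j \<le> n" by auto
      moreover have "0 \<le> w i" "0 \<le> v j"
        using assms x(2,3) by (simp_all add: admissible_def)
      ultimately show "x \<in> {i \<in> I. w i \<le> n} \<times> {j \<in> J. v j \<le> n}" by simp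
    qed
    show "finite \<dots>" using assms by (simp add: admissible_def)
  qed
  moreover have "0 \<le> w i + v j" if "i \<in> I" "j \<in> J" for i j
    using assms that by (simp add: admissible_def)
  ultimately show ?thesis
    unfolding admissible_def by (simp add: split_paired_all)
qed

lemma admissibleI:
  assumes "\<And>i. i \<in> I \<Longrightarrow> 0 \<le> w i" "\<And>n. {i \<in> I. w i \<le> n} \<subseteq> K n" "\<And>n. finite (K n)"
  shows "admissible I w"
  using assms unfolding admissible_def by (meson finite_subset)

lemma admissible_scale:
  assumes "admissible I w" "0 < k"
  shows "admissible I (\<lambda>i. int k * w i)"
proof (rule admissibleI)
  show "{i \<in> I. int k * w i \<le> n} \<subseteq> {i \<in> I. w i \<le> n}" for n
  proof
    fix i assume i: "i \<in> {i \<in> I. int k * w i \<le> n}"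
    then have "1 * w i \<le> int k * w i"
      using assms(2) admissible_nonneg[OF assms(1), of i] by (intro mult_right_mono) auto
    with i show "i \<in> {i \<in> I. w i \<le> n}" by auto
  qed
  show "finite {i \<in> I. w i \<le> n}" for n
    using assms(1) by (simp add: admissible_def)
qed (use admissible_nonneg[OF assms(1)] in simp)

lemma admissible_bij:
  assumes "bij_betw h I J" "\<And>i. i \<in> I \<Longrightarrow> v (h i) = w i"
  shows "admissible I w \<longleftrightarrow> admissible J v"
proof -
  have J: "J = h ` I" and inj: "inj_on h I"
    using assms(1) by (auto simp: bij_betw_def)
  have "{j \<in> J. v j \<le> n} = h ` {i \<in> I. w i \<le> n}" for n
    using assms(2) by (auto simp: J)
  moreover have "inj_on h {i \<in> I. w i \<le> n}" for n
    using inj by (rule inj_on_subset) auto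
  ultimately have "finite {j \<in> J. v j \<le> n} \<longleftrightarrow> finite {i \<in> I. w i \<le> n}" for n
    by (simp only: finite_image_iff)
  moreover have "(\<forall>j\<in>J. 0 \<le> v j) \<longleftrightarrow> (\<forall>i\<in>I. 0 \<le> w i)"
    using assms(2) by (simp add: J)
  ultimately show ?thesis
    by (simp only: admissible_def)
qed

lemma gf_bij:
  assumes "bij_betw h I J" "\<And>i. i \<in> I \<Longrightarrow> v (h i) = w i"
  shows "gf I w = gf J v"
proof -
  have "bij_betw h {i \<in> I. w i = n} {j \<in> J. v j = n}" for n
    using assms unfolding bij_betw_def inj_on_def by auto
  then have "(\<Sum>i | i \<in> I \<and> w i = n. 1) = (\<Sum>j | j \<in> J \<and> v j = n. (1::bit))" for n
    by (rule sum.reindex_bij_betw[where g = "\<lambda>_. 1"])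
  then show ?thesis by (simp add: fps_eq_iff gf_nth)
qed

lemma gf_cong: "I = J \<Longrightarrow> (\<And>i. i \<in> J \<Longrightarrow> w i = v i) \<Longrightarrow> gf I w = gf J v"
  by (rule gf_bij[of id]) simp_all

lemma gf_shift:
  "fps_X ^ k * gf I w = gf I (\<lambda>i. int k + w i)" if "admissible I w"
proof -
  have "fps_nth (fps_X ^ k * gf I w) n = fps_nth (gf I (\<lambda>i. int k + w i)) n" for n
  proof (cases "n < k")
    case True
    have "i \<in> I \<Longrightarrow> int k + w i \<noteq> int n" for i
      using admissible_nonneg[OF that, of i] True by linarith
    then have "{i. i \<in> I \<and> int k + w i = int n} = {}" by blast
    with True show ?thesis by (simp add: gf_nth fps_X_power_mult_nth del: sum_constant Collect_empty_eq)
  next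
    case False
    then have "{i. i \<in> I \<and> int k + w i = int n} = {i. i \<in> I \<and> w i = int (n - k)}"
      by auto
    with False show ?thesis by (simp add: gf_nth fps_X_power_mult_nth)
  qed
  then show ?thesis by (simp add: fps_eq_iff)
qed

lemma gf_compose:
  assumes "0 < k"
  shows "gf I w oo fps_X ^ k = gf I (\<lambda>i. int k * w i)"
proof -
  have "fps_nth (gf I w oo fps_X ^ k) n = fps_nth (gf I (\<lambda>i. int k * w i)) n" for n
  proof (cases "k dvd n")
    case True
    then obtain m where "n = k * m" by blast
    then have "{i. i \<in> I \<and> int k * w i = int n} = {i. i \<in> I \<and> w i = int (n div k)}"
      using assms by auto
    with True show ?thesis by (simp add: gf_nth fps_nth_compose_X_power)
  next
    case False
    then have "int k * w i \<noteq> int n" for i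
      by (metis dvd_triv_left int_dvd_int_iff)
    then have "{i. i \<in> I \<and> int k * w i = int n} = {}"
      by simp
    with False show ?thesis by (simp add: gf_nth fps_nth_compose_X_power del: Collect_empty_eq sum_constant)
  qed
  then show ?thesis by (simp add: fps_eq_iff)
qed

lemma gf_Un_disjoint:
  assumes "admissible I w" "admissible J w" "I \<inter> J = {}"
  shows "gf (I \<union> J) w = gf I w + gf J w"
proof -
  have "{i. i \<in> I \<union> J \<and> w i = n} = {i \<in> I. w i = n} \<union> {i \<in> J. w i = n}" for n
    by auto
  then have "fps_nth (gf (I \<union> J) w) n = fps_nth (gf I w + gf J w) n" for n
    using assms(3) by (simp add: gf_nth del: sum_constant) (subst sum.union_disjoint, auto intro: admissible_finite assms)
  then show ?thesis by (simp add: fps_eq_iff)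
qed

lemma gf_mult:
  assumes "admissible I w" "admissible J v"
  shows "gf I w * gf J v = gf (I \<times> J) (\<lambda>(i, j). w i + v j)"
proof -
  have "fps_nth (gf I w * gf J v) n = fps_nth (gf (I \<times> J) (\<lambda>(i, j). w i + v j)) n" for n
  proof -
    let ?S = "\<lambda>k. {i \<in> I. w i = int k} \<times> {j \<in> J. v j = int (n - k)}"
    have "fps_nth (gf I w * gf J v) n = (\<Sum>k=0..n. \<Sum>x\<in>?S k. 1)"
      by (simp add: fps_mult_nth gf_nth sum_product sum.cartesian_product del: sum_constant)
    also have "\<dots> = (\<Sum>x\<in>(\<Union>k\<in>{0..n}. ?S k). 1)"
      by (rule sum.UNION_disjoint[symmetric]) (auto intro!: finite_cartesian_product admissible_finite assms)
    also have "(\<Union>k\<in>{0..n}. ?S k) = {x. x \<in> I \<times> J \<and> (case x of (i, j) \<Rightarrow> w i + v j) = int n}"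
    proof (intro equalityI subsetI)
      fix x assume "x \<in> {x. x \<in> I \<times> J \<and> (case x of (i, j) \<Rightarrow> w i + v j) = int n}"
      then obtain i j where x: "x = (i, j)" "i \<in> I" "j \<in> J" "w i + v j = int n" by auto
      moreover have "0 \<le> w i" "0 \<le> v j"
        using assms x by (auto simp: admissible_def)
      ultimately have "x \<in> ?S (nat (w i))" "nat (w i) \<in> {0..n}" by auto
      then show "x \<in> (\<Union>k\<in>{0..n}. ?S k)" by blast
    qed auto
    finally show ?thesis by (simp only: gf_nth)
  qed
  then show ?thesis by (simp add: fps_eq_iff)
qed

text \<open>All cancellations below have this form: at each weight, \<open>h\<close> splits the
  symmetric difference of the index sets into pairs, and each pair contributes 1 + 1 = 0.\<close>

lemma gf_eq_involution:
  assumes "admissible I w" "admissible J w"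
    and h: "\<And>i. i \<in> I - J \<union> (J - I) \<Longrightarrow> h i \<in> I - J \<union> (J - I)"
      "\<And>i. i \<in> I - J \<union> (J - I) \<Longrightarrow> h (h i) = i"
      "\<And>i. i \<in> I - J \<union> (J - I) \<Longrightarrow> h i \<noteq> i"
      "\<And>i. i \<in> I - J \<union> (J - I) \<Longrightarrow> w (h i) = w i"
  shows "gf I w = gf J w"
proof -
  have "fps_nth (gf I w) n = fps_nth (gf J w) n" for n
  proof -
    let ?A = "{i \<in> I. w i = int n}" and ?B = "{i \<in> J. w i = int n}"
    let ?D = "{i \<in> I - J \<union> (J - I). w i = int n}"
    have fin: "finite ?A" "finite ?B" using assms(1,2) by (auto intro: admissible_finite)
    have "(\<Sum>i\<in>?D. 1) = (0::bit)"
      by (rule sum_involution_eq_0[where h = h]) (use h in auto)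
    also have "?D = (?A - ?B) \<union> (?B - ?A)" by auto
    also have "(\<Sum>i\<in>(?A - ?B) \<union> (?B - ?A). 1) = (\<Sum>i\<in>?A - ?B. 1) + (\<Sum>i\<in>?B - ?A. (1::bit))"
      by (rule sum.union_disjoint) (use fin in auto)
    finally have 0: "(\<Sum>i\<in>?A - ?B. 1) = (\<Sum>i\<in>?B - ?A. (1::bit))"
      by (simp only: bit_add_eq_0_iff)
    have "(\<Sum>i\<in>?A. 1) = (\<Sum>i\<in>?A \<inter> ?B. 1) + (\<Sum>i\<in>?A - ?B. (1::bit))"
      using sum.Int_Diff[OF fin(1), of "\<lambda>_. 1" ?B] by (simp only: Int_commute)
    moreover have "(\<Sum>i\<in>?B. 1) = (\<Sum>i\<in>?A \<inter> ?B. 1) + (\<Sum>i\<in>?B - ?A. (1::bit))"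
      using sum.Int_Diff[OF fin(2), of "\<lambda>_. 1" ?A] by (simp only: Int_commute)
    ultimately show ?thesis by (simp only: gf_nth 0)
  qed
  then show ?thesis by (simp add: fps_eq_iff)
qed

text \<open>Exchanging the two indices cancels everything off the diagonal.\<close>

lemma gf_square:
  assumes "admissible I w"
  shows "(gf I w)\<^sup>2 = gf I w oo fps_X ^ 2"
proof -
  let ?w = "\<lambda>(i, j). w i + w j"
  have "(gf I w)\<^sup>2 = gf (I \<times> I) ?w"
    using assms by (simp add: power2_eq_square gf_mult)
  also have "\<dots> = gf {(i, j). i \<in> I \<and> j = i} ?w"
  proof (rule gf_eq_involution[where h = prod.swap])
    show adm: "admissible (I \<times> I) ?w" by (rule admissible_Times[OF assms assms])
    show "admissible {(i, j). i \<in> I \<and> j = i} ?w" by (rule admissible_subset[OF adm]) auto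
    let ?D = "I \<times> I - {(i, j). i \<in> I \<and> j = i} \<union> ({(i, j). i \<in> I \<and> j = i} - I \<times> I)"
    fix x assume "x \<in> ?D"
    then obtain i j where x: "x = (i, j)" "i \<in> I" "j \<in> I" "i \<noteq> j" by auto
    then show "prod.swap x \<in> ?D" "prod.swap (prod.swap x) = x" "prod.swap x \<noteq> x" "?w (prod.swap x) = ?w x"
      by auto
  qed
  also have "\<dots> = gf I (\<lambda>i. int 2 * w i)"
    by (rule gf_bij[symmetric, of "\<lambda>i. (i, i)"]) (auto simp: bij_betw_def inj_on_def image_iff)
  also have "\<dots> = gf I w oo fps_X ^ 2" by (rule gf_compose[symmetric]) simp
  finally show ?thesis .
qed

text \<open>Every series over \<open>bit\<close> is the generating function of its own support, so
  the Frobenius identity follows from \<open>gf_square\<close>.\<close>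

lemma fps_bit_square: "(F :: bit fps)\<^sup>2 = F oo fps_X ^ 2"
proof -
  let ?I = "{n. fps_nth F n = 1}"
  have "{i \<in> ?I. int i \<le> n} \<subseteq> {..nat n}" for n by auto
  then have adm: "admissible ?I int"
    unfolding admissible_def by (auto intro: finite_subset)
  have "{i. fps_nth F i = 1 \<and> i = n} = (if fps_nth F n = 1 then {n} else {})" for n by auto
  then have "F = gf ?I int"
    by (simp add: fps_eq_iff gf_nth)
  with gf_square[OF adm] show ?thesis by simp
qed

subsection \<open>Substitution of powers of the variable\<close>

lemma compose_X_mult:
  fixes F G :: "bit fps"
  shows "0 < k \<Longrightarrow> (F * G) oo fps_X ^ k = (F oo fps_X ^ k) * (G oo fps_X ^ k)"
  by (simp add: fps_compose_mult_distrib)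

lemma compose_X_power:
  fixes F :: "bit fps"
  shows "0 < k \<Longrightarrow> F ^ n oo fps_X ^ k = (F oo fps_X ^ k) ^ n"
  by (simp add: fps_compose_power)

lemma compose_X_compose_X:
  fixes F :: "bit fps"
  assumes "0 < a" "0 < b"
  shows "(F oo fps_X ^ a) oo fps_X ^ b = F oo fps_X ^ (a * b)"
proof (rule fps_ext)
  fix n
  have "a * b dvd n \<longleftrightarrow> b dvd n \<and> a dvd n div b"
    using assms by (metis dvd_div_iff_mult dvd_mult_right mult_zero_right not_less_iff_gr_or_eq zero_less_mult_iff)
  then show "fps_nth ((F oo fps_X ^ a) oo fps_X ^ b) n = fps_nth (F oo fps_X ^ (a * b)) n"
    by (metis div_mult2_eq fps_nth_compose_X_power mult.commute)
qed

lemma compose_X_inject: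
  fixes F G :: "bit fps"
  assumes "F oo fps_X ^ k = G oo fps_X ^ k" "0 < k"
  shows "F = G"
proof (rule fps_ext)
  fix n
  have "fps_nth (F oo fps_X ^ k) (k * n) = fps_nth (G oo fps_X ^ k) (k * n)"
    by (simp only: assms(1))
  then show "fps_nth F n = fps_nth G n"
    using assms(2) by (simp add: fps_nth_compose_X_power)
qed

lemma X_compose_X: "0 < k \<Longrightarrow> (fps_X :: bit fps) oo fps_X ^ k = fps_X ^ k"
  by (simp add: fps_X_fps_compose_startby0)

subsection \<open>Euler products and theta functions\<close>

text \<open>The expanded product of 1 + q^s over s in \<open>S\<close>, which modulo 2 is also the
  product of 1 - q^s.\<close>

definition distinct_gf :: "nat set \<Rightarrow> bit fps" where
  "distinct_gf S = gf {T. finite T \<and> T \<subseteq> S} (\<lambda>T. int (\<Sum>T))"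

lemma admissible_distinct:
  assumes "0 \<notin> S"
  shows "admissible {T. finite T \<and> T \<subseteq> S} (\<lambda>T. int (\<Sum>T))"
proof -
  have "{T \<in> {T. finite T \<and> T \<subseteq> S}. int (\<Sum>T) \<le> n} \<subseteq> Pow {..nat n}" for n
  proof
    fix T assume T: "T \<in> {T \<in> {T. finite T \<and> T \<subseteq> S}. int (\<Sum>T) \<le> n}"
    then have "finite T" by simp
    have "t \<le> nat n" if "t \<in> T" for t
    proof -
      have "t \<le> \<Sum>T" using member_le_sum[of t T "\<lambda>x. x"] that \<open>finite T\<close> by simp
      then have "int t \<le> int (\<Sum>T)" by (simp only: of_nat_le_iff)
      also have "\<dots> \<le> n" using T by blast
      finally show ?thesis by simp
    qed
    then show "T \<in> Pow {..nat n}" by blast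
  qed
  then show ?thesis
    unfolding admissible_def by (auto intro: finite_subset simp del: of_nat_sum)
qed

lemma distinct_gf_Un:
  assumes "0 \<notin> S" "0 \<notin> S'" "S \<inter> S' = {}"
  shows "distinct_gf (S \<union> S') = distinct_gf S * distinct_gf S'"
proof -
  let ?F = "\<lambda>S. {T. finite T \<and> T \<subseteq> S}"
  have "bij_betw (\<lambda>(T, T'). T \<union> T') (?F S \<times> ?F S') (?F (S \<union> S'))"
  proof (rule bij_betw_byWitness[where f' = "\<lambda>T. (T \<inter> S, T \<inter> S')"])
    show "\<forall>x\<in>?F S \<times> ?F S'. (\<lambda>T. (T \<inter> S, T \<inter> S')) ((\<lambda>(T, T'). T \<union> T') x) = x"
      using assms(3) by auto
  qed auto
  moreover have "int (\<Sum>(T \<union> T')) = int (\<Sum>T) + int (\<Sum>T')"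
    if "finite T" "finite T'" "T \<subseteq> S" "T' \<subseteq> S'" for T T'
    using that assms(3) by (subst sum.union_disjoint) auto
  ultimately have "gf (?F S \<times> ?F S') (\<lambda>(T, T'). int (\<Sum>T) + int (\<Sum>T')) = gf (?F (S \<union> S')) (\<lambda>T. int (\<Sum>T))"
    by (intro gf_bij) auto
  then show ?thesis
    using assms by (simp add: distinct_gf_def gf_mult admissible_distinct del: of_nat_sum)
qed

lemma distinct_gf_image:
  assumes "inj_on h S"
  shows "distinct_gf (h ` S) = gf {T. finite T \<and> T \<subseteq> S} (\<lambda>T. int (\<Sum>t\<in>T. h t))"
  unfolding distinct_gf_def
proof (rule gf_bij[symmetric, of "image h"])
  show "bij_betw (image h) {T. finite T \<and> T \<subseteq> S} {T. finite T \<and> T \<subseteq> h ` S}"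
    unfolding bij_betw_def
  proof
    show "inj_on (image h) {T. finite T \<and> T \<subseteq> S}"
      using assms by (auto intro!: inj_onI simp: inj_on_image_eq_iff)
    show "image h ` {T. finite T \<and> T \<subseteq> S} = {T. finite T \<and> T \<subseteq> h ` S}"
      by (auto simp: image_iff) (metis finite_subset_image)
  qed
  fix T assume "T \<in> {T. finite T \<and> T \<subseteq> S}"
  then have "inj_on h T" using assms inj_on_subset by blast
  then show "int (\<Sum>(h ` T)) = int (\<Sum>t\<in>T. h t)" by (simp add: sum.reindex)
qed

lemma distinct_gf_scale:
  assumes "0 < k"
  shows "distinct_gf ((*) k ` S) = distinct_gf S oo fps_X ^ k"
proof -
  have "inj_on ((*) k) S" using assms by (simp add: inj_on_def)
  then have "distinct_gf ((*) k ` S) = gf {T. finite T \<and> T \<subseteq> S} (\<lambda>T. int (\<Sum>t\<in>T. k * t))"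
    by (rule distinct_gf_image)
  also have "\<dots> = gf {T. finite T \<and> T \<subseteq> S} (\<lambda>T. int k * int (\<Sum>T))"
    by (rule gf_cong) (simp_all add: sum_distrib_left)
  finally show ?thesis
    using assms by (simp add: distinct_gf_def gf_compose)
qed

text \<open>Only the empty set has sum 0, so the constant term is 1. Series over a field form an
  integral domain, so this is what allows Euler products to be cancelled later.\<close>

lemma distinct_gf_nonzero:
  assumes "0 \<notin> S"
  shows "distinct_gf S \<noteq> 0"
proof -
  have "T = {}" if "finite T" "T \<subseteq> S" "\<Sum>T = 0" for T
    using that assms by (auto simp: sum_eq_0_iff)
  then have "(finite T \<and> T \<subseteq> S) \<and> int (\<Sum>T) = int 0 \<longleftrightarrow> T = {}" for T
    by (cases "T = {}") (simp, metis of_nat_eq_iff)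
  then have "{T. (finite T \<and> T \<subseteq> S) \<and> int (\<Sum>T) = int 0} = {{}}"
    by (simp only: singleton_conv)
  then have "fps_nth (distinct_gf S) 0 = 1"
    by (simp only: distinct_gf_def gf_nth mem_Collect_eq) simp
  then show ?thesis by auto
qed

text \<open>The reduction of f_k modulo 2, where signs do not matter.\<close>

definition euler :: "nat \<Rightarrow> bit fps" where
  "euler k = distinct_gf {n. 0 < n \<and> k dvd n}"

lemma euler_mult:
  assumes "0 < k"
  shows "euler (m * k) = euler m oo fps_X ^ k"
proof -
  have "{n. 0 < n \<and> m * k dvd n} = (*) k ` {n. 0 < n \<and> m dvd n}"
    using assms by (auto simp: image_iff dvd_def mult_ac)
  then show ?thesis by (simp add: euler_def distinct_gf_scale assms)
qed

lemma euler_nonzero: "euler k \<noteq> 0"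
  by (simp add: euler_def distinct_gf_nonzero)

lemma euler_double: "euler (k * 2) = (euler k)\<^sup>2"
  by (simp add: euler_mult fps_bit_square[of "euler k"])

definition tri :: "int \<Rightarrow> int" where
  "tri n = n * (n - 1) div 2"

lemma two_tri: "2 * tri n = n * (n - 1)"
  by (simp add: tri_def)

lemma tri_eqI: "2 * m = n * (n - 1) \<Longrightarrow> tri n = m"
  using two_tri[of n] by simp

text \<open>The bilateral series of the triple product with nome q^N and argument q^r; its
  alternating signs disappear modulo 2.\<close>

definition theta :: "int \<Rightarrow> int \<Rightarrow> bit fps" where
  "theta N r = gf UNIV (\<lambda>n. N * tri n + r * n)"

text \<open>For negative \<open>n\<close> one has \<open>tri n >= - n\<close>, so the quadratic term
  outweighs \<open>r * n\<close> by at least (N - r) |n|. The bound yields both admissibility and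
  the constant term 1.\<close>

lemma theta_exponent_ge:
  assumes "0 < r" "r < N"
  shows "\<bar>n\<bar> \<le> N * tri n + r * n"
proof (cases "0 \<le> n")
  case True
  have "0 \<le> n * (n - 1)" using True by (cases "n = 0") auto
  then have "0 \<le> N * tri n" using two_tri[of n] assms by simp
  moreover have "1 * n \<le> r * n" using True assms by (intro mult_right_mono) auto
  ultimately show ?thesis using True by simp
next
  case False
  then have "0 \<le> (- n) * (- n - 1)" by (intro mult_nonneg_nonneg) auto
  then have "- n \<le> tri n" using two_tri[of n] by (simp add: algebra_simps)
  then have "N * (- n) \<le> N * tri n" using assms by (intro mult_left_mono) auto
  moreover have "1 * (- n) \<le> (N - r) * (- n)" using False assms by (intro mult_right_mono) auto
  ultimately show ?thesis using False by (simp add: algebra_simps)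
qed

lemma admissible_intI:
  assumes "\<And>n. n \<in> I \<Longrightarrow> 0 \<le> w n" "\<And>n. n \<in> I \<Longrightarrow> \<bar>n\<bar> \<le> w n + c"
  shows "admissible I (w :: int \<Rightarrow> int)"
proof -
  have "{i \<in> I. w i \<le> n} \<subseteq> {- (n + c)..n + c}" for n
    using assms(2) by fastforce
  then show ?thesis
    using assms(1) unfolding admissible_def by (meson finite_atLeastAtMost_int finite_subset)
qed

lemma admissible_theta:
  assumes "0 < r" "r < N"
  shows "admissible UNIV (\<lambda>n. N * tri n + r * n)"
  using theta_exponent_ge[OF assms] by (intro admissible_intI[where c = 0]) (auto intro: order_trans[OF abs_ge_zero])

subsection \<open>The Jacobi triple product modulo 2\<close>

definition charge :: "nat set \<times> nat set \<Rightarrow> int" where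
  "charge = (\<lambda>(A, B). int (card A) - int (card B))"

text \<open>The sum of the occupied positions a >= 0 minus the sum of the vacated positions -1 - b;
  hence a hole b costs b + 1.\<close>

definition energy :: "nat set \<times> nat set \<Rightarrow> int" where
  "energy = (\<lambda>(A, B). int (\<Sum>A) + int (\<Sum>B) + int (card B))"

definition states :: "(nat set \<times> nat set) set" where
  "states = {(A, B). finite A \<and> finite B}"

text \<open>A pair \<open>(A, B)\<close> describes the set \<open>A \<union> {- 1 - b | b \<notin> B}\<close> of integers (a Dirac sea with
  particles \<open>A\<close> and holes \<open>B\<close>); \<open>shift\<close> translates it by one.\<close>
definition shift :: "nat set \<times> nat set \<Rightarrow> nat set \<times> nat set" where
  "shift = (\<lambda>(A, B). (if 0 \<in> B then Suc ` A else insert 0 (Suc ` A), Suc -` B))"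

lemma Suc_image_vimage: "Suc ` (Suc -` S) = S - {0}"
proof -
  have "x \<in> Suc ` (Suc -` S) \<longleftrightarrow> x \<in> S - {0}" for x by (cases x) auto
  then show ?thesis by blast
qed

text \<open>Exchanging particles and holes reflects the line by x to -1 - x and complements the set,
  so the conjugated shift translates in the opposite direction and inverts
  \<open>shift\<close>.\<close>

lemma shift_swap: "shift (prod.swap (shift (prod.swap x))) = x"
proof (cases x)
  case (Pair A B)
  show ?thesis
    by (cases "0 \<in> A"; cases "0 \<in> B")
      (auto simp: Pair shift_def Suc_image_vimage insert_absorb inj_vimage_image_eq simp del: image_vimage_eq)
qed

text \<open>The cases ask whether position -1 is vacant; if it is occupied, translation creates a
  new particle at 0.\<close>

lemma hole_cases:
  assumes "finite B"
  obtains B' where "finite B'" "Suc -` B = B'" "0 \<in> B" "B = insert 0 (Suc ` B')"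
    | B' where "finite B'" "Suc -` B = B'" "0 \<notin> B" "B = Suc ` B'"
proof -
  have "finite (Suc -` B)" using assms by (simp add: finite_vimageI)
  then show ?thesis
    using that Suc_image_vimage[of B] by (metis Diff_empty Diff_insert0 insert_Diff)
qed

lemma sum_Suc_image: "finite A \<Longrightarrow> \<Sum>(Suc ` A) = \<Sum>A + card A"
  using sum_Suc[of "\<lambda>x. x" A] by (simp add: sum.reindex)

text \<open>Every particle gains one unit of energy and every hole loses one. A hole at -1
  disappears after losing its single unit, and a particle arriving at 0 costs nothing, so the net
  change is the charge.\<close>

lemma shift_state:
  assumes "x \<in> states"
  shows "shift x \<in> states" "charge (shift x) = charge x + 1" "energy (shift x) = energy x + charge x"
proof -
  obtain A B where x: "x = (A, B)" "finite A" "finite B"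
    using assms by (auto simp: states_def)
  have "shift x \<in> states \<and> charge (shift x) = charge x + 1 \<and> energy (shift x) = energy x + charge x"
    using x(3)
  proof (cases rule: hole_cases)
    case (1 B')
    have "\<Sum>B = \<Sum>(Suc ` B')" "card B = Suc (card B')"
      using 1(1) by (simp_all add: 1(4) card_image)
    with 1 x show ?thesis
      by (simp add: shift_def states_def charge_def energy_def card_image sum_Suc_image del: of_nat_sum)
  next
    case (2 B')
    have "card (insert 0 (Suc ` A)) = Suc (card A)" "\<Sum>(insert 0 (Suc ` A)) = \<Sum>(Suc ` A)"
      using x(2) by (simp_all add: card_image)
    moreover have "card B = card B'"
      by (simp add: 2(4) card_image)
    moreover have "\<Sum>B = \<Sum>B' + card B'"
      using sum_Suc_image[OF 2(1)] 2(4) by simp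
    ultimately show ?thesis
      using 2 x by (simp add: shift_def states_def charge_def energy_def sum_Suc_image del: of_nat_sum)
  qed
  then show "shift x \<in> states" "charge (shift x) = charge x + 1" "energy (shift x) = energy x + charge x"
    by auto
qed

lemma bij_shift: "bij_betw shift {x \<in> states. charge x = l} {x \<in> states. charge x = l + 1}"
proof (rule bij_betw_byWitness[where f' = "\<lambda>x. prod.swap (shift (prod.swap x))"])
  have swap: "prod.swap x \<in> states \<longleftrightarrow> x \<in> states" "charge (prod.swap x) = - charge x" for x
    by (cases x; auto simp: states_def charge_def)+
  show "\<forall>x\<in>{x \<in> states. charge x = l}. prod.swap (shift (prod.swap (shift x))) = x"
    using shift_swap by (metis swap_swap)
  show "\<forall>x\<in>{x \<in> states. charge x = l + 1}. shift (prod.swap (shift (prod.swap x))) = x"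
    by (simp add: shift_swap)
  show "shift ` {x \<in> states. charge x = l} \<subseteq> {x \<in> states. charge x = l + 1}"
    using shift_state by auto
  show "(\<lambda>x. prod.swap (shift (prod.swap x))) ` {x \<in> states. charge x = l + 1} \<subseteq> {x \<in> states. charge x = l}"
    by (simp add: image_subset_iff swap shift_state)
qed

text \<open>Translating step by step from charge 0 to charge l costs 0 + 1 + ... + (l - 1), which is
  \<open>tri l\<close>; negative l uses the inverse shift.\<close>

lemma charge_bijection:
  "\<exists>h. bij_betw h {x \<in> states. charge x = 0} {x \<in> states. charge x = l} \<and>
       (\<forall>x\<in>{x \<in> states. charge x = 0}. energy (h x) = energy x + tri l)"
proof (induction l rule: int_induct[where k = 0])
  case base
  show ?case by (rule exI[of _ id]) (simp add: tri_def bij_betw_id flip: id_def)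
next
  case (step1 l)
  then obtain h where h: "bij_betw h {x \<in> states. charge x = 0} {x \<in> states. charge x = l}"
    "\<forall>x\<in>{x \<in> states. charge x = 0}. energy (h x) = energy x + tri l" by blast
  have "tri (l + 1) = tri l + l" by (rule tri_eqI) (use two_tri[of l] in \<open>simp add: algebra_simps\<close>)
  moreover have "h x \<in> states" "charge (h x) = l" if "x \<in> states" "charge x = 0" for x
    using bij_betwE[OF h(1)] that by blast+
  ultimately have "\<forall>x\<in>{x \<in> states. charge x = 0}. energy ((shift \<circ> h) x) = energy x + tri (l + 1)"
    using h(2) shift_state(3) by auto
  then show ?case using bij_betw_trans[OF h(1) bij_shift] by blast
next
  case (step2 l)
  then obtain h where h: "bij_betw h {x \<in> states. charge x = 0} {x \<in> states. charge x = l}"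
    "\<forall>x\<in>{x \<in> states. charge x = 0}. energy (h x) = energy x + tri l" by blast
  let ?M = "{x \<in> states. charge x = l - 1}"
  have bij: "bij_betw shift ?M {x \<in> states. charge x = l}"
    using bij_shift[of "l - 1"] by simp
  let ?g = "inv_into ?M shift"
  have "tri (l - 1) = tri l - (l - 1)" by (rule tri_eqI) (use two_tri[of l] in \<open>simp add: algebra_simps\<close>)
  moreover have "energy (?g y) = energy y - (l - 1)" if "y \<in> states" "charge y = l" for y
  proof -
    have "?g y \<in> ?M" using bij_betwE[OF bij_betw_inv_into[OF bij]] that by blast
    moreover have "shift (?g y) = y" using bij_betw_inv_into_right[OF bij] that by blast
    ultimately show ?thesis using shift_state(3)[of "?g y"] by auto
  qed
  moreover have "h x \<in> states" "charge (h x) = l" if "x \<in> states" "charge x = 0" for x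
    using bij_betwE[OF h(1)] that by blast+
  ultimately have "\<forall>x\<in>{x \<in> states. charge x = 0}. energy ((?g \<circ> h) x) = energy x + tri (l - 1)"
    using h(2) by auto
  then show ?case using bij_betw_trans[OF h(1) bij_betw_inv_into[OF bij]] by blast
qed

text \<open>Neutral states are Frobenius symbols of partitions, so this is 1 / f_1;
  \<open>neutral_gf_euler\<close> obtains that without a bijection to partitions.\<close>

definition neutral_gf :: "bit fps" where
  "neutral_gf = gf {x \<in> states. charge x = 0} energy"

lemma admissible_states: "admissible states energy"
proof -
  have "{x \<in> states. energy x \<le> n} \<subseteq> Pow {..nat n} \<times> Pow {..nat n}" for n
  proof
    fix x assume "x \<in> {x \<in> states. energy x \<le> n}"
    then obtain A B where x: "x = (A, B)" "finite A" "finite B" "energy (A, B) \<le> n"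
      by (auto simp: states_def)
    have "int (\<Sum>A) \<le> n" "int (\<Sum>B) \<le> n"
      using x(4) by (simp_all add: energy_def del: of_nat_sum)
    moreover have "int a \<le> int (\<Sum>S)" if "finite S" "a \<in> S" for a and S :: "nat set"
      using member_le_sum[of a S "\<lambda>x. x"] that by (simp only: of_nat_le_iff)
    ultimately have "int a \<le> n" if "a \<in> A \<union> B" for a
      using that x(2,3) by (meson Un_iff order_trans)
    then have "a \<le> nat n" if "a \<in> A \<union> B" for a
      using that by fastforce
    then show "x \<in> Pow {..nat n} \<times> Pow {..nat n}" by (auto simp: x(1))
  qed
  then show ?thesis
    by (rule admissibleI[rotated]) (auto simp: energy_def states_def simp del: of_nat_sum)
qed

definition residue_class :: "nat \<Rightarrow> nat \<Rightarrow> nat set" where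
  "residue_class N r = {n. n mod N = r}"

lemma distinct_gf_residue_class:
  assumes "r < N"
  shows "distinct_gf (residue_class N r) = gf {T. finite T} (\<lambda>T. int N * int (\<Sum>T) + int r * int (card T))"
proof -
  have "residue_class N r = range (\<lambda>n. N * n + r)"
    using assms by (auto simp: residue_class_def image_iff) (metis mult_div_mod_eq)
  moreover have "inj (\<lambda>n. N * n + r)" using assms by (simp add: inj_def)
  ultimately have "distinct_gf (residue_class N r) = gf {T. finite T \<and> T \<subseteq> UNIV} (\<lambda>T. int (\<Sum>t\<in>T. N * t + r))"
    by (simp only: distinct_gf_image)
  also have "\<dots> = gf {T. finite T} (\<lambda>T. int N * int (\<Sum>T) + int r * int (card T))"
    by (rule gf_cong) (simp_all add: sum.distrib sum_distrib_left mult.commute)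
  finally show ?thesis .
qed

lemma admissible_residue_class:
  assumes "r < N"
  shows "admissible {T. finite T} (\<lambda>T. int N * int (\<Sum>T) + int r * int (card T))"
proof (rule admissibleI)
  fix n
  show "{T \<in> {T. finite T}. int N * int (\<Sum>T) + int r * int (card T) \<le> n} \<subseteq> Pow {..nat n}"
  proof
    fix T assume "T \<in> {T \<in> {T. finite T}. int N * int (\<Sum>T) + int r * int (card T) \<le> n}"
    then have T: "finite T" "int N * int (\<Sum>T) + int r * int (card T) \<le> n" by blast+
    have "t \<le> nat n" if "t \<in> T" for t
    proof -
      have "t \<le> \<Sum>T" using member_le_sum[of t T "\<lambda>x. x"] that T(1) by simp
      then have "1 * t \<le> N * \<Sum>T" using assms by (intro mult_mono) auto
      then have "int t \<le> int N * int (\<Sum>T)" by (simp only: flip: of_nat_mult)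
      moreover have "0 \<le> int r * int (card T)" by simp
      ultimately show ?thesis using T(2) by linarith
    qed
    then show "T \<in> Pow {..nat n}" by blast
  qed
qed (simp_all del: of_nat_sum)

text \<open>Write the parts as N a + r and N (b + 1) - r: their total is N times the energy plus r
  times the charge of the state (A, B). Each sector of charge l is a copy of the neutral one with
  energy raised by \<open>tri l\<close>, so the sum over l splits off as a theta series.\<close>

lemma residue_pair_product:
  assumes "0 < r" "r < N"
  shows "distinct_gf (residue_class N r) * distinct_gf (residue_class N (N - r)) =
         (neutral_gf oo fps_X ^ N) * theta (int N) (int r)"
proof -
  let ?F = "{T :: nat set. finite T}" and ?M = "{x \<in> states. charge x = 0}"
  let ?w = "\<lambda>s T. int N * int (\<Sum>T) + int s * int (card T)"
  let ?v = "\<lambda>(x, l). int N * energy x + (int N * tri l + int r * l)"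
  have "distinct_gf (residue_class N r) * distinct_gf (residue_class N (N - r)) =
        gf (?F \<times> ?F) (\<lambda>(A, B). ?w r A + ?w (N - r) B)"
  proof -
    have "admissible ?F (?w r)" "admissible ?F (?w (N - r))"
      by (rule admissible_residue_class; use assms in simp)+
    moreover have "distinct_gf (residue_class N r) = gf ?F (?w r)"
      "distinct_gf (residue_class N (N - r)) = gf ?F (?w (N - r))"
      by (rule distinct_gf_residue_class; use assms in simp)+
    ultimately show ?thesis by (simp only: gf_mult)
  qed
  also have "\<dots> = gf states (\<lambda>x. int N * energy x + int r * charge x)"
    using assms by (intro gf_cong) (auto simp: states_def energy_def charge_def of_nat_diff algebra_simps simp del: of_nat_sum)
  also have "\<dots> = gf (?M \<times> UNIV) ?v"
  proof -
    have "\<exists>h. \<forall>l. bij_betw (h l) ?M {x \<in> states. charge x = l} \<and>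
                (\<forall>x\<in>?M. energy (h l x) = energy x + tri l)"
      by (rule choice) (intro allI charge_bijection)
    then obtain h where h: "\<And>l. bij_betw (h l) ?M {x \<in> states. charge x = l}"
      "\<And>l x. x \<in> ?M \<Longrightarrow> energy (h l x) = energy x + tri l"
      by blast
    have in_states: "h l x \<in> states" "charge (h l x) = l" if "x \<in> ?M" for l x
      using bij_betwE[OF h(1)] that by blast+
    have "bij_betw (\<lambda>(x, l). h l x) (?M \<times> UNIV) states"
      unfolding bij_betw_def
    proof
      show "inj_on (\<lambda>(x, l). h l x) (?M \<times> UNIV)"
      proof (rule inj_onI, clarify)
        fix x l x' l'
        assume *: "x \<in> states" "charge x = 0" "x' \<in> states" "charge x' = 0" "h l x = h l' x'"
        then have "l = l'" using in_states[of x l] in_states[of x' l'] by simp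
        moreover have "inj_on (h l) ?M" using h(1) by (rule bij_betw_imp_inj_on)
        ultimately show "x = x' \<and> l = l'" using * by (auto dest: inj_onD)
      qed
      show "(\<lambda>(x, l). h l x) ` (?M \<times> UNIV) = states"
      proof
        show "(\<lambda>(x, l). h l x) ` (?M \<times> UNIV) \<subseteq> states" using in_states by auto
        show "states \<subseteq> (\<lambda>(x, l). h l x) ` (?M \<times> UNIV)"
        proof
          fix y assume "y \<in> states"
          then have "y \<in> h (charge y) ` ?M" using bij_betw_imp_surj_on[OF h(1)] by auto
          then show "y \<in> (\<lambda>(x, l). h l x) ` (?M \<times> UNIV)" by force
        qed
      qed
    qed
    then show ?thesis
    proof (rule gf_bij[symmetric])
      fix xl assume "xl \<in> ?M \<times> (UNIV :: int set)"
      then obtain x l where "xl = (x, l)" "x \<in> ?M" by auto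
      then show "int N * energy (case xl of (x, l) \<Rightarrow> h l x) + int r * charge (case xl of (x, l) \<Rightarrow> h l x) = ?v xl"
        using h(2)[of x l] in_states[of x l] by (simp add: algebra_simps)
    qed
  qed
  also have "\<dots> = gf ?M (\<lambda>x. int N * energy x) * theta (int N) (int r)"
  proof -
    have M: "admissible ?M energy" using admissible_states by (rule admissible_subset) auto
    then have "admissible ?M (\<lambda>x. int N * energy x)"
      using assms by (intro admissible_scale) auto
    moreover have "admissible UNIV (\<lambda>l. int N * tri l + int r * l)"
      using assms by (intro admissible_theta) auto
    ultimately show ?thesis by (simp add: theta_def gf_mult)
  qed
  also have "gf ?M (\<lambda>x. int N * energy x) = neutral_gf oo fps_X ^ N"
    using assms by (simp add: neutral_gf_def gf_compose)
  finally show ?thesis .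
qed

text \<open>The exponent is a square, so n and -n cancel for nonzero n.\<close>

lemma theta_2_1: "theta 2 1 = 1"
proof -
  have sq: "2 * tri n + 1 * n = n\<^sup>2" for n
    using two_tri[of n] by (simp add: power2_eq_square algebra_simps)
  have "theta 2 1 = gf {0} (\<lambda>n. 2 * tri n + 1 * n)"
    unfolding theta_def
  proof (rule gf_eq_involution[where h = uminus])
    show *: "admissible UNIV (\<lambda>n. 2 * tri n + 1 * n)" by (rule admissible_theta) auto
    show "admissible {0} (\<lambda>n. 2 * tri n + 1 * n)" by (rule admissible_subset[OF *]) auto
  qed (simp_all only: sq power2_minus, simp_all)
  also have "\<dots> = 1"
  proof (rule fps_ext)
    fix n
    have "{i. i \<in> {0} \<and> 2 * tri i + 1 * i = int n} = (if n = 0 then {0} else {})"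
      by (auto simp: tri_def)
    then show "fps_nth (gf {0} (\<lambda>n. 2 * tri n + 1 * n)) n = fps_nth 1 n"
      by (simp only: gf_nth) simp
  qed
  finally show ?thesis .
qed

lemma odd_distinct_gf: "distinct_gf (residue_class 2 1) * euler 2 = euler 1"
proof -
  have "{n::nat. 0 < n \<and> 1 dvd n} = residue_class 2 1 \<union> {n. 0 < n \<and> 2 dvd n}"
    by (auto simp: residue_class_def)
  moreover have "distinct_gf (residue_class 2 1 \<union> {n. 0 < n \<and> 2 dvd n}) = distinct_gf (residue_class 2 1) * euler 2"
    unfolding euler_def by (rule distinct_gf_Un) (auto simp: residue_class_def)
  ultimately show ?thesis by (simp add: euler_def)
qed

text \<open>The constant of the triple product is found from the case \<open>N = 2\<close>, \<open>r = 1\<close>, where modulo 2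
  both sides are squares.\<close>
lemma neutral_gf_euler: "neutral_gf * euler 1 = 1"
proof -
  have "neutral_gf oo fps_X ^ 2 = (distinct_gf (residue_class 2 1))\<^sup>2"
    using residue_pair_product[of 1 2] by (simp add: theta_2_1 power2_eq_square)
  also have "\<dots> = distinct_gf (residue_class 2 1) oo fps_X ^ 2" by (rule fps_bit_square)
  finally have "neutral_gf = distinct_gf (residue_class 2 1)" by (rule compose_X_inject) simp
  then have "neutral_gf * euler 1 * euler 1 = 1 * euler 1"
    using odd_distinct_gf euler_double[of 1] by (simp add: power2_eq_square mult.assoc)
  then show ?thesis using euler_nonzero[of 1] by (simp only: mult_cancel_right) simp
qed

text \<open>The unknown factor in \<open>residue_pair_product\<close> is \<open>neutral_gf\<close>
  at q^N, which \<open>euler N\<close> inverts.\<close>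

theorem jacobi_triple_product_mod_2:
  assumes "0 < r" "r < N"
  shows "distinct_gf (residue_class N r) * distinct_gf (residue_class N (N - r)) * euler N = theta (int N) (int r)"
proof -
  have "(neutral_gf oo fps_X ^ N) * euler N = (neutral_gf * euler 1) oo fps_X ^ N"
    using assms euler_mult[of N 1] by (simp add: compose_X_mult)
  also have "\<dots> = 1" by (simp add: neutral_gf_euler del: One_nat_def)
  finally show ?thesis
    using residue_pair_product[OF assms] by (simp add: mult_ac)
qed

lemma euler_values: "euler 2 = (euler 1)\<^sup>2" "euler 4 = (euler 1) ^ 4" "euler 6 = (euler 3)\<^sup>2"
  using euler_double[of 1] euler_double[of 2] euler_double[of 3] by (simp_all flip: power_mult)

subsection \<open>Theta functions as Euler products\<close>

text \<open>Shaped as an introduction rule, so that repeated application peels one residue class at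
  a time off a union.\<close>

lemma distinct_gf_residue_UnI:
  assumes "distinct_gf S = F" "0 < r" "r < N" "0 \<notin> S" "residue_class N r \<inter> S = {}"
  shows "distinct_gf (residue_class N r \<union> S) = distinct_gf (residue_class N r) * F"
  using assms distinct_gf_Un[of "residue_class N r" S] by (simp add: residue_class_def)

text \<open>Euler's pentagonal number theorem modulo 2: the classes 1 and 2 modulo 3 and the
  multiples of 3 exhaust the positive integers.\<close>

lemma theta_3_1: "theta 3 1 = euler 1"
proof -
  have "{n::nat. 0 < n \<and> 1 dvd n} = residue_class 3 1 \<union> (residue_class 3 2 \<union> {n. 0 < n \<and> 3 dvd n})"
    by (auto simp: residue_class_def) presburger
  then have "euler 1 = distinct_gf (residue_class 3 1) * (distinct_gf (residue_class 3 2) * euler 3)"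
    unfolding euler_def
    by (simp only:) (intro distinct_gf_residue_UnI refl; force simp: residue_class_def)
  then show ?thesis
    using jacobi_triple_product_mod_2[of 1 3] by (simp add: mult_ac)
qed

text \<open>Jacobi's series for the cube of f_1: the classes 1 and 3 modulo 4 form the odd numbers,
  so the triple product is f_1 f_4 / f_2, and modulo 2 this is f_1^3.\<close>

lemma theta_4_1: "theta 4 1 = (euler 1) ^ 3"
proof -
  have "residue_class 2 1 = residue_class 4 1 \<union> residue_class 4 3"
    by (auto simp: residue_class_def) presburger+
  then have "distinct_gf (residue_class 2 1) = distinct_gf (residue_class 4 1) * distinct_gf (residue_class 4 3)"
    by (simp only:) (intro distinct_gf_residue_UnI refl; force simp: residue_class_def)
  then have "theta 4 1 = distinct_gf (residue_class 2 1) * euler 4"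
    using jacobi_triple_product_mod_2[of 1 4] by simp
  then have "theta 4 1 * euler 2 = euler 1 * euler 4"
    using odd_distinct_gf by (simp add: mult_ac)
  then have "theta 4 1 * (euler 1)\<^sup>2 = (euler 1) ^ 3 * (euler 1)\<^sup>2"
    by (simp add: euler_values algebra_simps power2_eq_square power3_eq_cube power4_eq_xxxx del: One_nat_def)
  then show ?thesis using euler_nonzero[of 1] by (simp only: mult_cancel_right) simp
qed

text \<open>The classes 1 and 5 modulo 6 are the odd numbers prime to 3, so the triple product is
  f_1 f_6^2 / (f_2 f_3), which modulo 2 is f_3^3 / f_1.\<close>

lemma theta_6_1: "theta 6 1 * euler 1 = (euler 3) ^ 3"
proof -
  let ?P = "\<lambda>r. distinct_gf (residue_class 6 r)"
  have "residue_class 2 1 = residue_class 6 1 \<union> (residue_class 6 3 \<union> residue_class 6 5)"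
    by (auto simp: residue_class_def) presburger+
  then have 1: "distinct_gf (residue_class 2 1) = ?P 1 * (?P 3 * ?P 5)"
    by (simp only:) (intro distinct_gf_residue_UnI refl; force simp: residue_class_def)
  have "{n::nat. 0 < n \<and> 3 dvd n} = residue_class 6 3 \<union> {n. 0 < n \<and> 6 dvd n}"
    by (auto simp: residue_class_def) presburger+
  then have 3: "euler 3 = ?P 3 * euler 6"
    unfolding euler_def
    by (simp only:) (intro distinct_gf_residue_UnI refl; force simp: residue_class_def)
  have th: "theta 6 1 = ?P 1 * ?P 5 * euler 6"
    using jacobi_triple_product_mod_2[of 1 6] by simp
  have "theta 6 1 * euler 3 * euler 2 = distinct_gf (residue_class 2 1) * euler 2 * euler 6 * euler 6"
    unfolding 1 3 th by (simp only: mult_ac)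
  also have "\<dots> = euler 1 * (euler 3) ^ 4"
    using odd_distinct_gf by (simp add: euler_values(3) algebra_simps power2_eq_square power4_eq_xxxx del: One_nat_def)
  finally have "theta 6 1 * euler 1 * (euler 3 * euler 1) = euler 3 ^ 3 * (euler 3 * euler 1)"
    by (simp only: euler_values(1) power2_eq_square power3_eq_cube power4_eq_xxxx mult_ac)
  then show ?thesis using euler_nonzero[of 3] euler_nonzero[of 1] by (simp only: mult_cancel_right) simp
qed

text \<open>The three triple products together use each class modulo 9 prime to 3 once, giving f_1 /
  f_3, and contribute three factors f_9.\<close>

lemma theta_9_product: "theta 9 1 * theta 9 2 * theta 9 4 * euler 3 = euler 1 * (euler 9) ^ 3"
proof -
  let ?P = "\<lambda>r. distinct_gf (residue_class 9 r)"
  have "{n::nat. 0 < n \<and> 1 dvd n} = residue_class 9 1 \<union> (residue_class 9 8 \<union> (residue_class 9 2 \<union>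
      (residue_class 9 7 \<union> (residue_class 9 4 \<union> (residue_class 9 5 \<union> {n. 0 < n \<and> 3 dvd n})))))"
    by (auto simp: residue_class_def) presburger+
  then have "euler 1 = ?P 1 * (?P 8 * (?P 2 * (?P 7 * (?P 4 * (?P 5 * euler 3)))))"
    unfolding euler_def
    by (simp only:) (intro distinct_gf_residue_UnI refl; (simp add: residue_class_def disjoint_iff; presburger?))
  moreover have "theta 9 1 = ?P 1 * ?P 8 * euler 9" "theta 9 2 = ?P 2 * ?P 7 * euler 9" "theta 9 4 = ?P 4 * ?P 5 * euler 9"
    using jacobi_triple_product_mod_2[of 1 9] jacobi_triple_product_mod_2[of 2 9] jacobi_triple_product_mod_2[of 4 9]
    by simp_all
  ultimately show ?thesis by (simp add: algebra_simps power2_eq_square power3_eq_cube power4_eq_xxxx)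
qed

lemma theta_reflect: "theta N (N - r) = theta N r"
  unfolding theta_def
proof (rule gf_bij[of uminus])
  show "bij_betw uminus UNIV (UNIV :: int set)" by (rule bij_uminus)
  show "N * tri (- n) + r * (- n) = N * tri n + (N - r) * n" for n
  proof -
    have "tri (- n) = tri n + n" by (rule tri_eqI) (use two_tri[of n] in \<open>simp add: algebra_simps\<close>)
    then show ?thesis by (simp add: algebra_simps)
  qed
qed

lemma theta_scale: "theta (int k * N) (int k * r) = theta N r oo fps_X ^ k" if "0 < k"
  using that by (simp add: theta_def gf_compose algebra_simps)

lemma theta_9_3: "theta 9 3 = euler 3"
  using theta_scale[of 3 3 1] euler_mult[of 3 1] by (simp add: theta_3_1)

section \<open>Dissections of theta series by the residue of the summation index\<close>

lemma gf_dissect_2: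
  fixes w :: "int \<Rightarrow> int"
  assumes "admissible UNIV w"
  shows "gf UNIV w = gf UNIV (\<lambda>m. w (2 * m)) + gf UNIV (\<lambda>m. w (2 * m + 1))"
proof -
  let ?I = "\<lambda>i. range (\<lambda>m::int. 2 * m + i)"
  have "UNIV = ?I 0 \<union> ?I 1" by (auto simp: image_iff) presburger
  moreover have "gf (?I 0 \<union> ?I 1) w = gf (?I 0) w + gf (?I 1) w"
    by (rule gf_Un_disjoint) (auto intro: admissible_subset[OF assms], presburger)
  moreover have I: "gf (?I i) w = gf UNIV (\<lambda>m. w (2 * m + i))" for i
    by (rule gf_bij[symmetric, of "\<lambda>m. 2 * m + i"]) (auto simp: bij_betw_def inj_def)
  ultimately show ?thesis using I[of 0] by simp
qed

lemma gf_dissect_3: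
  fixes w :: "int \<Rightarrow> int"
  assumes "admissible UNIV w"
  shows "gf UNIV w = gf UNIV (\<lambda>m. w (3 * m)) + gf UNIV (\<lambda>m. w (3 * m + 1)) + gf UNIV (\<lambda>m. w (3 * m + 2))"
proof -
  let ?I = "\<lambda>i. range (\<lambda>m::int. 3 * m + i)"
  have "UNIV = (?I 0 \<union> ?I 1) \<union> ?I 2" by (auto simp: image_iff) presburger
  moreover have "gf ((?I 0 \<union> ?I 1) \<union> ?I 2) w = gf (?I 0 \<union> ?I 1) w + gf (?I 2) w"
    by (rule gf_Un_disjoint) (auto intro: admissible_subset[OF assms], presburger+)
  moreover have "gf (?I 0 \<union> ?I 1) w = gf (?I 0) w + gf (?I 1) w"
    by (rule gf_Un_disjoint) (auto intro: admissible_subset[OF assms], presburger)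
  moreover have I: "gf (?I i) w = gf UNIV (\<lambda>m. w (3 * m + i))" for i
    by (rule gf_bij[symmetric, of "\<lambda>m. 3 * m + i"]) (auto simp: bij_betw_def inj_def)
  ultimately show ?thesis using I[of 0] by simp
qed

lemma gf_reflect:
  fixes w v :: "int \<Rightarrow> int"
  assumes "\<And>m. w m = v (c - m)"
  shows "gf UNIV w = gf UNIV v"
  by (rule gf_bij[of "\<lambda>m. c - m"]) (auto simp: assms intro!: bij_betw_byWitness[where f' = "\<lambda>m. c - m"])

lemma gf_theta_scale_shift:
  assumes "0 < r" "r < N" "\<And>m. w m = int a + int k * (N * tri (c - m) + r * (c - m))" "0 < k"
  shows "gf UNIV w = fps_X ^ a * (theta N r oo fps_X ^ k)"
proof -
  have "gf UNIV w = gf UNIV (\<lambda>m. int a + int k * (N * tri m + r * m))"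
    by (rule gf_reflect) (rule assms(3))
  also have "\<dots> = fps_X ^ a * gf UNIV (\<lambda>m. int k * (N * tri m + r * m))"
    by (rule gf_shift[symmetric]) (intro admissible_scale admissible_theta assms)
  also have "gf UNIV (\<lambda>m. int k * (N * tri m + r * m)) = theta N r oo fps_X ^ k"
    using assms(4) by (simp add: theta_def gf_compose)
  finally show ?thesis .
qed

text \<open>Split \<open>theta 4 1\<close> by the index modulo 3. The class 1 gives q times the same
  series at q^9; the classes 0 and 2 are the even and odd halves of \<open>theta 9 3\<close>, which
  is f_3.\<close>

lemma euler_cube_dissection: "(euler 1) ^ 3 = euler 3 + fps_X * (euler 9) ^ 3"
proof -
  let ?w = "\<lambda>n. 4 * tri n + 1 * n" and ?v = "\<lambda>n. 9 * tri n + 3 * n"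
  have w: "?w n = 2 * n * n - n" for n using two_tri[of n] by (simp add: algebra_simps)
  have v: "2 * ?v n = 9 * n * n - 3 * n" for n using two_tri[of n] by (simp add: algebra_simps)
  have "(euler 1) ^ 3 = gf UNIV (\<lambda>m. ?w (3 * m)) + gf UNIV (\<lambda>m. ?w (3 * m + 1)) + gf UNIV (\<lambda>m. ?w (3 * m + 2))"
    using gf_dissect_3[OF admissible_theta[of 1 4]] theta_4_1 by (simp add: theta_def)
  moreover have "gf UNIV (\<lambda>m. ?w (3 * m + 1)) = fps_X ^ 1 * (theta 4 1 oo fps_X ^ 9)"
    by (rule gf_theta_scale_shift[where c = 0]) (simp_all only: w, simp_all add: algebra_simps)
  moreover have "theta 4 1 oo fps_X ^ 9 = (euler 9) ^ 3"
    using euler_mult[of 9 1] by (simp add: theta_4_1 compose_X_power)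
  moreover have "euler 3 = gf UNIV (\<lambda>m. ?v (2 * m)) + gf UNIV (\<lambda>m. ?v (2 * m + 1))"
    using gf_dissect_2[OF admissible_theta[of 3 9]] theta_9_3 by (simp add: theta_def)
  moreover have "gf UNIV (\<lambda>m. ?w (3 * m)) = gf UNIV (\<lambda>m. ?v (2 * m))"
  proof (rule gf_cong)
    show "?w (3 * m) = ?v (2 * m)" for m
      using v[of "2 * m"] by (simp only: w) (simp add: algebra_simps)
  qed simp
  moreover have "gf UNIV (\<lambda>m. ?w (3 * m + 2)) = gf UNIV (\<lambda>m. ?v (2 * m + 1))"
  proof (rule gf_reflect)
    show "?w (3 * m + 2) = ?v (2 * (- 1 - m) + 1)" for m
      using v[of "2 * (- 1 - m) + 1"] by (simp only: w) (simp add: algebra_simps)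
  qed
  ultimately show ?thesis by (simp add: algebra_simps)
qed

text \<open>The index modulo 3 in \<open>theta 9 3\<close> determines the exponent modulo 9. In
  \<open>factor_gf_euler\<close> these three pieces are the theta functions that the three Kronecker
  sums leave uncancelled.\<close>

lemma euler_3_dissection:
  "euler 3 = (theta 9 4 oo fps_X ^ 9) + fps_X ^ 3 * (theta 9 2 oo fps_X ^ 9) + fps_X ^ 6 * (theta 9 1 oo fps_X ^ 9)"
proof -
  let ?v = "\<lambda>n. 9 * tri n + 3 * n"
  have v: "2 * ?v n = 9 * n * n - 3 * n" for n using two_tri[of n] by (simp add: algebra_simps)
  have "euler 3 = gf UNIV (\<lambda>m. ?v (3 * m)) + gf UNIV (\<lambda>m. ?v (3 * m + 1)) + gf UNIV (\<lambda>m. ?v (3 * m + 2))"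
    using gf_dissect_3[OF admissible_theta[of 3 9]] theta_9_3 by (simp add: theta_def)
  moreover have "gf UNIV (\<lambda>m. ?v (3 * m)) = fps_X ^ 0 * (theta 9 5 oo fps_X ^ 9)"
  proof (rule gf_theta_scale_shift[where c = 0])
    show "?v (3 * m) = int 0 + int 9 * (9 * tri (0 - m) + 5 * (0 - m))" for m
      using v[of "3 * m"] two_tri[of "- m"] by (simp add: algebra_simps)
  qed auto
  moreover have "theta 9 5 = theta 9 4" using theta_reflect[of 9 4] by simp
  moreover have "gf UNIV (\<lambda>m. ?v (3 * m + 1)) = fps_X ^ 3 * (theta 9 2 oo fps_X ^ 9)"
  proof (rule gf_theta_scale_shift[where c = 0])
    show "?v (3 * m + 1) = int 3 + int 9 * (9 * tri (0 - m) + 2 * (0 - m))" for m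
      using v[of "3 * m + 1"] two_tri[of "- m"] by (simp add: algebra_simps)
  qed auto
  \<comment> \<open>The class 2 is traversed backwards as the class -1, which puts its exponent into
    theta form.\<close>
  moreover have "gf UNIV (\<lambda>m. ?v (3 * m + 2)) = gf UNIV (\<lambda>m. ?v (3 * (- m) - 1))"
    by (rule gf_reflect[where c = "- 1"]) (simp add: algebra_simps)
  moreover have "gf UNIV (\<lambda>m. ?v (3 * (- m) - 1)) = fps_X ^ 6 * (theta 9 1 oo fps_X ^ 9)"
  proof (rule gf_theta_scale_shift[where c = 0])
    show "?v (3 * (- m) - 1) = int 6 + int 9 * (9 * tri (0 - m) + 1 * (0 - m))" for m
      using v[of "3 * (- m) - 1"] two_tri[of "- m"] by (simp add: algebra_simps)
  qed auto
  ultimately show ?thesis by simp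
qed

text \<open>Odd indices reproduce the series at q^4, which is its fourth power by applying Frobenius
  twice. Only this odd part is used later, so the even part stays an unspecified
  \<open>G\<close>.\<close>

lemma theta_6_1_dissection: "\<exists>G. theta 6 1 = (G oo fps_X ^ 2) + fps_X * (theta 6 1) ^ 4"
proof -
  let ?w = "\<lambda>n. 6 * tri n + 1 * n"
  have w: "?w n = 3 * n * n - 2 * n" for n using two_tri[of n] by (simp add: algebra_simps)
  have "theta 6 1 = gf UNIV (\<lambda>m. ?w (2 * m)) + gf UNIV (\<lambda>m. ?w (2 * m + 1))"
    using gf_dissect_2[OF admissible_theta[of 1 6]] by (simp add: theta_def)
  moreover have "gf UNIV (\<lambda>m. ?w (2 * m)) = gf UNIV (\<lambda>m. 6 * m * m - 2 * m) oo fps_X ^ 2"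
    by (simp only: w gf_compose[of 2]) (simp add: algebra_simps)
  moreover have "gf UNIV (\<lambda>m. ?w (2 * m + 1)) = fps_X ^ 1 * (theta 6 1 oo fps_X ^ 4)"
    by (rule gf_theta_scale_shift[where c = 0]) (simp_all only: w, simp_all add: algebra_simps)
  moreover have "theta 6 1 oo fps_X ^ 4 = (theta 6 1) ^ 4"
  proof -
    have "(theta 6 1) ^ 4 = ((theta 6 1)\<^sup>2)\<^sup>2" by (simp flip: power_mult)
    also have "\<dots> = (theta 6 1 oo fps_X ^ 2) oo fps_X ^ 2"
      by (simp only: fps_bit_square[of "theta 6 1"] fps_bit_square[of "theta 6 1 oo fps_X ^ 2"])
    also have "\<dots> = theta 6 1 oo fps_X ^ (2 * 2)" by (rule compose_X_compose_X) simp_all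
    finally show ?thesis by simp
  qed
  ultimately show ?thesis by auto
qed

subsection \<open>Kronecker's identity modulo 2\<close>

definition same_sign :: "(int \<times> int) set" where
  "same_sign = {(m, n). 0 \<le> m \<and> 0 \<le> n \<or> m < 0 \<and> n < 0}"

text \<open>Summing over n gives the bilateral Lambert series of q^(r m) / (1 - q^(N m + s)); the
  minus sign of the negative quadrant vanishes modulo 2.\<close>

definition kronecker_sum :: "int \<Rightarrow> int \<Rightarrow> int \<Rightarrow> bit fps" where
  "kronecker_sum N r s = gf same_sign (\<lambda>(m, n). N * m * n + r * m + s * n)"

text \<open>Summing over m gives the series of q^(N n (n + 1) / 2) / (1 - q^(N n + r)), classically
  the partial fraction expansion of f_N^3 / \<open>theta N r\<close>.\<close>

definition kronecker_factor :: "int \<Rightarrow> int \<Rightarrow> bit fps" where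
  "kronecker_factor N r = gf same_sign (\<lambda>(m, n). N * (tri (n + 1) + m * n) + r * m)"

lemma admissible_pairI:
  assumes "\<And>m n. (m, n) \<in> I \<Longrightarrow> \<bar>m\<bar> \<le> w m n" "\<And>m n. (m, n) \<in> I \<Longrightarrow> \<bar>n\<bar> \<le> w m n"
  shows "admissible I (\<lambda>(m, n). w m n :: int)"
proof (rule admissibleI)
  show "0 \<le> (case i of (m, n) \<Rightarrow> w m n)" if "i \<in> I" for i
    using assms(1)[of "fst i" "snd i"] that by (cases i) (simp add: order_trans[OF abs_ge_zero])
  show "{i \<in> I. (case i of (m, n) \<Rightarrow> w m n) \<le> k} \<subseteq> {-k..k} \<times> {-k..k}" for k
  proof clarify
    fix m n assume "(m, n) \<in> I" "w m n \<le> k"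
    with assms(1)[of m n] assms(2)[of m n] show "m \<in> {-k..k} \<and> n \<in> {-k..k}" by auto
  qed
qed auto

lemma admissible_kronecker_sum:
  assumes "0 < r" "0 < s" "r + s < N"
  shows "admissible same_sign (\<lambda>(m, n). N * m * n + r * m + s * n)"
proof -
  have "\<bar>m\<bar> \<le> N * m * n + r * m + s * n \<and> \<bar>n\<bar> \<le> N * m * n + r * m + s * n"
    if "(m, n) \<in> same_sign" for m n
  proof (cases "0 \<le> m")
    case True
    then have n: "0 \<le> n" using that by (auto simp: same_sign_def)
    have "0 \<le> N * m * n" using True n assms by simp
    moreover have "1 * m \<le> r * m" "1 * n \<le> s * n"
      using True n assms by (intro mult_right_mono; simp)+
    ultimately show ?thesis using True n by linarith
  next
    case False
    then have n: "n < 0" using that by (auto simp: same_sign_def)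
    \<comment> \<open>In these variables the negative quadrant becomes a, b >= 0, and since N - r -
      s >= 1 the exponent is a + b + 1 plus nonnegative terms.\<close>
    define a b where ab: "a = - m - 1" "b = - n - 1"
    then have "0 \<le> a" "0 \<le> b" using False n by auto
    moreover from this have "0 \<le> r * (a * b)" "0 \<le> s * (a * b)" "0 \<le> r * b" "0 \<le> s * a" "0 \<le> a * b"
      "0 \<le> (N - r - s - 1) * (a * b + a + b + 1)"
      using assms by auto
    moreover have "N * m * n + r * m + s * n =
       (N - r - s - 1) * (a * b + a + b + 1) + r * (a * b) + r * b + s * (a * b) + s * a + a * b + a + b + 1"
      unfolding ab by (simp add: algebra_simps)
    moreover have "\<bar>m\<bar> = a + 1" "\<bar>n\<bar> = b + 1" using False n by (auto simp: ab)
    ultimately show ?thesis by linarith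
  qed
  then show ?thesis by (intro admissible_pairI) auto
qed

lemma tri_nonneg: "0 \<le> tri n"
proof -
  have "0 \<le> n * (n - 1)" by (cases "0 < n") (auto simp: zero_le_mult_iff)
  then show ?thesis using two_tri[of n] by simp
qed

lemma admissible_kronecker_factor:
  assumes "0 < r" "r < N"
  shows "admissible same_sign (\<lambda>(m, n). N * (tri (n + 1) + m * n) + r * m)"
proof -
  have "\<bar>m\<bar> \<le> N * (tri (n + 1) + m * n) + r * m \<and> \<bar>n\<bar> \<le> N * (tri (n + 1) + m * n) + r * m"
    if "(m, n) \<in> same_sign" for m n
  proof (cases "0 \<le> m")
    case True
    then have n: "0 \<le> n" using that by (auto simp: same_sign_def)
    have "0 \<le> N * (m * n)" using True n assms by simp
    moreover have "1 * m \<le> r * m" using True assms by (intro mult_right_mono) auto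
    moreover have "tri (n + 1) = tri n + n"
      by (rule tri_eqI) (use two_tri[of n] in \<open>simp add: algebra_simps\<close>)
    then have "n \<le> tri (n + 1)" using tri_nonneg[of n] by simp
    then have "1 * n \<le> N * tri (n + 1)" using assms n by (intro mult_mono) auto
    ultimately show ?thesis using True n by (simp add: algebra_simps)
  next
    case False
    then have n: "n < 0" using that by (auto simp: same_sign_def)
    define a b where ab: "a = - m - 1" "b = - n - 1"
    then have "0 \<le> a" "0 \<le> b" using False n by auto
    moreover from this have "0 \<le> r * (a * b)" "0 \<le> r * b" "0 \<le> a * b"
      "0 \<le> (N - r - 1) * (a * b + a + b + 1)" "0 \<le> N * tri (n + 1)"
      using assms tri_nonneg by auto
    moreover have "N * (tri (n + 1) + m * n) + r * m = N * tri (n + 1) +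
       (N - r - 1) * (a * b + a + b + 1) + r * (a * b) + r * b + a * b + a + b + 1"
      unfolding ab by (simp add: algebra_simps)
    moreover have "\<bar>m\<bar> = a + 1" "\<bar>n\<bar> = b + 1" using False n by (auto simp: ab)
    ultimately show ?thesis by linarith
  qed
  then show ?thesis by (intro admissible_pairI) auto
qed

lemma kronecker_sum_sym: "kronecker_sum N r s = kronecker_sum N s r"
  unfolding kronecker_sum_def
proof (rule gf_bij[of prod.swap])
  show "bij_betw prod.swap same_sign same_sign"
    by (rule bij_betw_byWitness[where f' = prod.swap]) (auto simp: same_sign_def)
qed (auto simp: algebra_simps)

text \<open>In the variables \<open>l\<close>, \<open>m\<close>, \<open>n\<close> both sides are sums of the same monomials, over regions that
  differ by full lines in the direction of \<open>n\<close>. On such a line \<open>n \<mapsto> - 1 - 2 m - n\<close> preserves the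
  exponent: this is the vanishing of the theta function at its zero.\<close>
lemma theta_kronecker_sum:
  assumes "0 < r" "0 < s" "r + s < N"
  shows "theta N s * kronecker_sum N r s = kronecker_factor N r * theta N (r + s)"
proof -
  let ?W = "\<lambda>(l, m, n). N * (tri l + tri (n + 1) + m * n) + r * (m + l) + s * l"
  let ?L = "{(l, m, n). (m + l, n) \<in> same_sign}" and ?R = "{(l, m, n). (m, n) \<in> same_sign} :: (int \<times> int \<times> int) set"
  let ?wL = "\<lambda>(k, x). (N * tri k + s * k) + (case x of (m, n) \<Rightarrow> N * m * n + r * m + s * n)"
  let ?wR = "\<lambda>(x, l). (case x of (m, n) \<Rightarrow> N * (tri (n + 1) + m * n) + r * m) + (N * tri l + (r + s) * l)"
  \<comment> \<open>On the left, l = k + n collects the two terms with \<open>s\<close> into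
    \<open>s * l\<close>; replacing m by m - l then turns \<open>r * m\<close> into
    \<open>r * (m + l)\<close>. On the right the variables are only reordered.\<close>
  let ?hL = "\<lambda>(k, m, n). (n + k, m - n - k, n)" and ?hR = "\<lambda>((m, n), l). (l, m, n)"
  have adm: "admissible UNIV (\<lambda>n. N * tri n + s * n)" "admissible UNIV (\<lambda>n. N * tri n + (r + s) * n)"
    "admissible same_sign (\<lambda>(m, n). N * m * n + r * m + s * n)"
    "admissible same_sign (\<lambda>(m, n). N * (tri (n + 1) + m * n) + r * m)"
    using assms by (auto intro!: admissible_theta admissible_kronecker_sum admissible_kronecker_factor)
  have L: "bij_betw ?hL (UNIV \<times> same_sign) ?L"
    by (rule bij_betw_byWitness[where f' = "\<lambda>(l, m, n). (l - n, m + l, n)"]) auto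
  have R: "bij_betw ?hR (same_sign \<times> UNIV) ?R"
    by (rule bij_betw_byWitness[where f' = "\<lambda>(l, m, n). ((m, n), l)"]) auto
  have wL: "?W (?hL x) = ?wL x" for x
  proof -
    obtain k m n where x: "x = (k, m, n)" by (cases x) auto
    have "tri (n + k) + tri (n + 1) = tri k + n * n + n * k"
      using two_tri[of "n + k"] two_tri[of "n + 1"] two_tri[of k] by (simp add: algebra_simps)
    then have "tri (n + k) + tri (n + 1) + (m - n - k) * n = tri k + m * n"
      by (simp add: algebra_simps)
    then show ?thesis by (simp add: x) (simp add: algebra_simps)
  qed
  have wR: "?W (?hR x) = ?wR x" for x
    by (cases x) (auto simp: algebra_simps)
  have admL: "admissible ?L ?W"
    using admissible_bij[OF L, of ?W ?wL] wL admissible_Times[OF adm(1,3)] by simp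
  have admR: "admissible ?R ?W"
    using admissible_bij[OF R, of ?W ?wR] wR admissible_Times[OF adm(4,2)] by simp
  have "theta N s * kronecker_sum N r s = gf (UNIV \<times> same_sign) ?wL"
    unfolding theta_def kronecker_sum_def by (rule gf_mult) (rule adm)+
  also have "\<dots> = gf ?L ?W" by (rule gf_bij[OF L]) (rule wL)
  also have "\<dots> = gf ?R ?W"
  proof (rule gf_eq_involution[OF admL admR, where h = "\<lambda>(l, m, n). (l, m, - 1 - 2 * m - n)"])
    fix x assume "x \<in> ?L - ?R \<union> (?R - ?L)"
    \<comment> \<open>If m + l and m have the same sign, both regions contain the same n; otherwise
      every n lies in exactly one of them.\<close>
    then obtain l m n where x: "x = (l, m, n)" "(0 \<le> m + l) \<noteq> (0 \<le> m)"
      by (auto simp: same_sign_def)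
    then show "(\<lambda>(l, m, n). (l, m, - 1 - 2 * m - n)) x \<in> ?L - ?R \<union> (?R - ?L)"
      by (auto simp: same_sign_def)
    show "(\<lambda>(l, m, n). (l, m, - 1 - 2 * m - n)) ((\<lambda>(l, m, n). (l, m, - 1 - 2 * m - n)) x) = x"
      by (simp add: x)
    \<comment> \<open>A fixed point would satisfy 2 n = -1 - 2 m, which parity forbids.\<close>
    show "(\<lambda>(l, m, n). (l, m, - 1 - 2 * m - n)) x \<noteq> x"
      by (simp add: x) presburger
    have "tri (- 1 - 2 * m - n + 1) + m * (- 1 - 2 * m - n) = tri (n + 1) + m * n"
      using two_tri[of "- 1 - 2 * m - n + 1"] two_tri[of "n + 1"] by (simp add: algebra_simps)
    then show "?W ((\<lambda>(l, m, n). (l, m, - 1 - 2 * m - n)) x) = ?W x"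
      by (simp add: x)
  qed
  also have "\<dots> = gf (same_sign \<times> UNIV) ?wR" by (rule gf_bij[OF R, symmetric]) (rule wR)
  also have "\<dots> = kronecker_factor N r * theta N (r + s)"
    unfolding theta_def kronecker_factor_def by (rule gf_mult[symmetric]) (rule adm)+
  finally show ?thesis .
qed

lemma theta_nonzero:
  assumes "0 < r" "r < N"
  shows "theta N r \<noteq> 0"
proof -
  have "N * tri n + r * n = int 0 \<longleftrightarrow> n = 0" for n
    using theta_exponent_ge[OF assms, of n] by (auto simp: tri_def)
  then have "fps_nth (theta N r) 0 = 1"
    by (simp only: theta_def gf_nth UNIV_I simp_thms singleton_conv) simp
  then show ?thesis by auto
qed

text \<open>The Kronecker sum is symmetric in r and s, so comparing
  \<open>theta_kronecker_sum\<close> with its mirror image shows that this product is independent of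
  the parameter. It can then be evaluated at one convenient value.\<close>

lemma kronecker_factor_theta:
  assumes "0 < r" "0 < s" "r + s < N"
  shows "kronecker_factor N r * theta N r = kronecker_factor N s * theta N s"
proof -
  have "theta N s * kronecker_sum N r s = kronecker_factor N r * theta N (r + s)"
    using assms by (rule theta_kronecker_sum)
  moreover have "theta N r * kronecker_sum N r s = kronecker_factor N s * theta N (r + s)"
    using theta_kronecker_sum[of s r N] assms kronecker_sum_sym[of N r s] by (simp add: add.commute)
  ultimately have "kronecker_factor N r * theta N r * theta N (r + s) = kronecker_factor N s * theta N s * theta N (r + s)"
    by (metis (no_types, lifting) mult.assoc mult.commute)
  then show ?thesis
    using theta_nonzero[of "r + s" N] assms by (simp only: mult_cancel_right) simp
qed

text \<open>With equal parameters the exponent is symmetric in m and n, so the pairs off the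
  diagonal cancel.\<close>

lemma kronecker_sum_diagonal:
  assumes "0 < r" "2 * r < N"
  shows "kronecker_sum N r r = gf UNIV (\<lambda>n. N * n * n + 2 * r * n)"
proof -
  let ?w = "\<lambda>(m, n). N * m * n + r * m + r * n"
  have adm: "admissible same_sign ?w" using assms by (intro admissible_kronecker_sum) auto
  have "kronecker_sum N r r = gf {(m, n). m = n} ?w"
    unfolding kronecker_sum_def
  proof (rule gf_eq_involution[where h = prod.swap])
    show "admissible same_sign ?w" by (rule adm)
    show "admissible {(m, n). m = n} ?w"
      by (rule admissible_subset[OF adm]) (auto simp: same_sign_def)
    let ?D = "same_sign - {(m, n). m = n} \<union> ({(m, n). m = n} - same_sign)"
    fix x assume "x \<in> ?D"
    then obtain m n where x: "x = (m, n)" "(m, n) \<in> same_sign" "m \<noteq> n" by (auto simp: same_sign_def)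
    then show "prod.swap x \<in> ?D" "prod.swap (prod.swap x) = x" "prod.swap x \<noteq> x" "?w (prod.swap x) = ?w x"
      by (auto simp: same_sign_def)
  qed
  also have "\<dots> = gf UNIV (\<lambda>n. N * n * n + 2 * r * n)"
    by (rule gf_bij[symmetric, of "\<lambda>n. (n, n)"]) (auto simp: bij_betw_def inj_def)
  finally show ?thesis .
qed

text \<open>For r = s = 3 the theta functions on both sides of \<open>theta_kronecker_sum\<close>
  coincide by reflection, so the factor equals the Kronecker sum. Its diagonal is
  \<open>theta 6 1\<close> at q^3, known from \<open>theta_6_1\<close>.\<close>

lemma kronecker_factor_9_3: "kronecker_factor 9 3 * theta 9 3 = (euler 9) ^ 3"
proof -
  have "theta 9 6 = theta 9 3" using theta_reflect[of 9 3] by simp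
  then have "theta 9 3 * kronecker_sum 9 3 3 = theta 9 3 * kronecker_factor 9 3"
    using theta_kronecker_sum[of 3 3 9] by (simp add: mult.commute)
  then have "kronecker_sum 9 3 3 = kronecker_factor 9 3"
    using theta_nonzero[of 3 9] by (simp only: mult_cancel_left) simp
  moreover have "kronecker_sum 9 3 3 = gf UNIV (\<lambda>n. int 3 * (6 * tri n + 1 * n))"
  proof -
    have "9 * n * n + 2 * 3 * n = int 3 * (6 * tri (0 - n) + 1 * (0 - n))" for n :: int
      using two_tri[of "- n"] by (simp add: algebra_simps)
    then have "gf UNIV (\<lambda>n. 9 * n * n + 2 * 3 * n) = gf UNIV (\<lambda>n. int 3 * (6 * tri n + 1 * n))"
      by (rule gf_reflect)
    then show ?thesis
      using kronecker_sum_diagonal[of 3 9] by simp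
  qed
  then have "kronecker_sum 9 3 3 = theta 6 1 oo fps_X ^ 3"
    by (simp only: gf_compose[of 3] theta_def)
  moreover have "(theta 6 1 oo fps_X ^ 3) * euler 3 = (euler 9) ^ 3"
    using arg_cong[OF theta_6_1, of "\<lambda>F. F oo fps_X ^ 3"] euler_mult[of 3 1] euler_mult[of 3 3]
    by (simp add: compose_X_mult compose_X_power)
  ultimately show ?thesis by (simp add: theta_9_3)
qed

text \<open>The condition on r + s makes \<open>theta 9 (r + s)\<close> equal to f_3, and the
  constant of \<open>kronecker_factor_theta\<close> is carried over from the value at 3.\<close>

lemma kronecker_sum_9:
  assumes "r \<in> {1, 2}" "0 < s" "r + s \<in> {3, 6}"
  shows "theta 9 r * theta 9 s * kronecker_sum 9 r s = (euler 9) ^ 3 * euler 3"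
proof -
  have "theta 9 (r + s) = euler 3"
    using assms(3) theta_9_3 theta_reflect[of 9 3] by auto
  moreover have "kronecker_factor 9 r * theta 9 r = (euler 9) ^ 3"
    using kronecker_factor_theta[of r 3 9] assms(1) kronecker_factor_9_3 by auto
  moreover have "theta 9 s * kronecker_sum 9 r s = kronecker_factor 9 r * theta 9 (r + s)"
    using assms by (intro theta_kronecker_sum) auto
  ultimately show ?thesis by (metis (no_types, lifting) mult.assoc mult.commute)
qed

subsection \<open>The parity of the number of 9-regular partitions of odd numbers\<close>

definition regular_gf :: "bit fps" where
  "regular_gf = Abs_fps (\<lambda>n. of_nat (num_regular_partitions 9 n))"

definition regular_odd_gf :: "bit fps" where
  "regular_odd_gf = Abs_fps (\<lambda>n. of_nat (num_regular_partitions 9 (2 * n + 1)))"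

definition regular_multisets :: "nat multiset set" where
  "regular_multisets = {P. \<forall>x\<in>#P. \<not> 9 dvd x}"

lemma regular_partitions_9: "regular_partitions 9 n = {P \<in> regular_multisets. int (\<Sum>\<^sub># P) = int n}"
  by (auto simp: regular_partitions_def regular_multisets_def simp del: of_nat_sum_mset intro: gr0I)

lemma regular_gf_eq: "regular_gf = gf regular_multisets (\<lambda>P. int (\<Sum>\<^sub># P))"
  by (simp add: fps_eq_iff regular_gf_def gf_nth num_regular_partitions_def regular_partitions_9 del: of_nat_eq_iff of_nat_sum_mset)

lemma admissible_regular: "admissible regular_multisets (\<lambda>P. int (\<Sum>\<^sub># P))"
proof (rule admissibleI)
  fix n
  show "{P \<in> regular_multisets. int (\<Sum>\<^sub># P) \<le> n} \<subseteq> (\<Union>k\<in>{..nat n}. regular_partitions 9 k)"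
  proof
    fix P assume P: "P \<in> {P \<in> regular_multisets. int (\<Sum>\<^sub># P) \<le> n}"
    then have "P \<in> regular_partitions 9 (\<Sum>\<^sub># P)" by (simp add: regular_partitions_9)
    moreover have "\<Sum>\<^sub># P \<in> {..nat n}" using P by (simp add: le_nat_iff del: of_nat_sum_mset)
    ultimately show "P \<in> (\<Union>k\<in>{..nat n}. regular_partitions 9 k)" by blast
  qed
qed (auto intro: finite_regular_partitions simp del: of_nat_sum_mset)

text \<open>As in the cancellation of complete against elementary symmetric functions, one copy of
  the largest part changes sides, with priority to the copy in the set. The maximum of the union
  stays the same, so a second application undoes the first, and only the empty pair is
  exceptional.\<close>

definition toggle_max :: "nat multiset \<times> nat set \<Rightarrow> nat multiset \<times> nat set" where
  "toggle_max = (\<lambda>(P, T). let m = Max (set_mset P \<union> T) in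
     if m \<in> T then (add_mset m P, T - {m}) else (P - {#m#}, insert m T))"

lemma regular_gf_distinct: "regular_gf * distinct_gf {n. \<not> 9 dvd n} = 1"
proof -
  let ?D = "{T :: nat set. finite T \<and> T \<subseteq> {n. \<not> 9 dvd n}}"
  let ?w = "\<lambda>(P, T). int (\<Sum>\<^sub># P) + int (\<Sum>T)"
  let ?I = "regular_multisets \<times> ?D" and ?J = "{({#}, {})} :: (nat multiset \<times> nat set) set"
  have D: "admissible ?D (\<lambda>T. int (\<Sum>T))" by (rule admissible_distinct) simp
  have adm: "admissible ?I ?w" by (rule admissible_Times[OF admissible_regular D])
  have J: "?J \<subseteq> ?I" by (simp add: regular_multisets_def)
  have "regular_gf * distinct_gf {n. \<not> 9 dvd n} = gf ?I ?w"
    unfolding regular_gf_eq distinct_gf_def by (rule gf_mult[OF admissible_regular D])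
  also have "\<dots> = gf ?J ?w"
  proof (rule gf_eq_involution[OF adm admissible_subset[OF adm J], where h = toggle_max])
    fix x assume "x \<in> ?I - ?J \<union> (?J - ?I)"
    then obtain P T where x: "x = (P, T)" "P \<in> regular_multisets" "T \<in> ?D" "P \<noteq> {#} \<or> T \<noteq> {}"
      using J by auto
    define m where "m = Max (set_mset P \<union> T)"
    have fin: "finite (set_mset P \<union> T)" "set_mset P \<union> T \<noteq> {}" using x by auto
    then have m: "m \<in> set_mset P \<union> T" unfolding m_def by (rule Max_in)
    then have m9: "\<not> 9 dvd m" using x by (auto simp: regular_multisets_def)
    have "toggle_max x \<in> ?I - ?J \<and> toggle_max (toggle_max x) = x \<and> toggle_max x \<noteq> x \<and> ?w (toggle_max x) = ?w x"
    proof (cases "m \<in> T")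
      case True
      have t: "toggle_max x = (add_mset m P, T - {m})"
        using True by (simp add: toggle_max_def x(1) m_def Let_def)
      have "set_mset (add_mset m P) \<union> (T - {m}) = set_mset P \<union> T" using True by auto
      then have "toggle_max (add_mset m P, T - {m}) = (P, T)"
        using True by (simp add: toggle_max_def m_def[symmetric] Let_def insert_absorb)
      moreover have "\<Sum>T = m + \<Sum>(T - {m})" using True x(3) by (simp add: sum.remove)
      ultimately have "toggle_max (toggle_max x) = x" "?w (toggle_max x) = ?w x"
        unfolding t unfolding x(1) by (simp_all del: of_nat_sum of_nat_sum_mset)
      moreover have "toggle_max x \<in> ?I - ?J" "toggle_max x \<noteq> x"
        unfolding t using x m9 by (auto simp: regular_multisets_def)
      ultimately show ?thesis by blast
    next
      case False
      then have mP: "m \<in># P" using m by simp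
      have t: "toggle_max x = (P - {#m#}, insert m T)"
        using False by (simp add: toggle_max_def x(1) m_def Let_def)
      have "set_mset (P - {#m#}) \<union> insert m T = set_mset P \<union> T"
        using mP by (auto dest: in_diffD) (metis insert_DiffM insert_iff set_mset_add_mset_insert)
      then have "toggle_max (P - {#m#}, insert m T) = (P, T)"
        using False mP by (simp add: toggle_max_def m_def[symmetric] Let_def)
      moreover have "\<Sum>(insert m T) = m + \<Sum>T" using False x(3) by simp
      moreover have "\<Sum>\<^sub># P = m + \<Sum>\<^sub># (P - {#m#})" using mP by (rule sum_mset.remove)
      ultimately have "toggle_max (toggle_max x) = x" "?w (toggle_max x) = ?w x"
        unfolding t unfolding x(1) by (simp_all del: of_nat_sum of_nat_sum_mset)
      moreover have "toggle_max x \<in> ?I - ?J" "toggle_max x \<noteq> x"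
        unfolding t using x m9 False by (auto simp: regular_multisets_def dest: in_diffD)
      ultimately show ?thesis by blast
    qed
    then show "toggle_max x \<in> ?I - ?J \<union> (?J - ?I)" "toggle_max (toggle_max x) = x" "toggle_max x \<noteq> x" "?w (toggle_max x) = ?w x"
      by auto
  qed
  also have "\<dots> = 1"
  proof (rule fps_ext)
    fix n
    have "{i \<in> ?J. ?w i = int n} = (if n = 0 then ?J else {})" by auto
    then show "fps_nth (gf ?J ?w) n = fps_nth 1 n" by (simp only: gf_nth) simp
  qed
  finally show ?thesis .
qed

lemma regular_gf_euler: "regular_gf * euler 1 = euler 9"
proof -
  have "{n::nat. 0 < n \<and> 1 dvd n} = {n. \<not> 9 dvd n} \<union> {n. 0 < n \<and> 9 dvd n}"
    by (auto intro: gr0I)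
  then have "euler 1 = distinct_gf {n. \<not> 9 dvd n} * euler 9"
    unfolding euler_def by (simp only:) (rule distinct_gf_Un; auto)
  then show ?thesis using regular_gf_distinct by (simp add: mult.assoc[symmetric])
qed

lemma regular_gf_dissection: "\<exists>G. regular_gf = (G oo fps_X ^ 2) + fps_X * (regular_odd_gf oo fps_X ^ 2)"
proof
  let ?G = "Abs_fps (\<lambda>n. fps_nth regular_gf (2 * n))"
  show "regular_gf = (?G oo fps_X ^ 2) + fps_X * (regular_odd_gf oo fps_X ^ 2)"
  proof (rule fps_ext)
    fix n
    show "fps_nth regular_gf n = fps_nth ((?G oo fps_X ^ 2) + fps_X * (regular_odd_gf oo fps_X ^ 2)) n"
    proof (cases "even n")
      case True
      then have "n = 0 \<or> odd (n - 1)" by auto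
      then show ?thesis
        using True by (auto simp: fps_nth_compose_X_power)
    next
      case False
      then obtain k where "n = 2 * k + 1" by (elim oddE)
      then show ?thesis
        by (simp add: fps_nth_compose_X_power regular_odd_gf_def regular_gf_def)
    qed
  qed
qed

lemma odd_part_unique:
  fixes A A' B B' :: "bit fps"
  assumes "(A oo fps_X ^ 2) + fps_X * (B oo fps_X ^ 2) = (A' oo fps_X ^ 2) + fps_X * (B' oo fps_X ^ 2)"
  shows "B = B'"
proof (rule fps_ext)
  fix n
  show "fps_nth B n = fps_nth B' n"
    using arg_cong[OF assms, of "\<lambda>F. fps_nth F (2 * n + 1)"] by (simp add: fps_nth_compose_X_power)
qed

text \<open>Multiply f_9 / f_1 by f_1^4 f_18, a series in q^2, so that the odd part is only scaled.
  The result f_1^3 f_9 f_18 splits by \<open>euler_cube_dissection\<close> into f_3 f_9 f_18 and q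
  f_9^4 f_18. The second term is q times a series in q^2, and the first is f_6 T, whose odd part is
  known.\<close>

lemma regular_odd_gf_euler: "regular_odd_gf * euler 3 = (euler 9)\<^sup>2 * euler 1"
proof -
  define T where "T = theta 6 1 oo fps_X ^ 3"
  obtain G where G: "theta 6 1 = (G oo fps_X ^ 2) + fps_X * (theta 6 1) ^ 4"
    using theta_6_1_dissection by blast
  obtain E where E: "regular_gf = (E oo fps_X ^ 2) + fps_X * (regular_odd_gf oo fps_X ^ 2)"
    using regular_gf_dissection by blast
  have e2: "euler 2 oo fps_X ^ 2 = (euler 1) ^ 4" "euler 9 oo fps_X ^ 2 = euler 18" "euler 18 oo fps_X ^ 2 = (euler 9) ^ 4"
    "euler 3 oo fps_X ^ 2 = euler 6"
    using euler_mult[of 2 2] euler_mult[of 2 9] euler_mult[of 2 18] euler_mult[of 2 3] euler_values(2)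
      euler_double[of 9] euler_double[of 18] by (simp_all flip: power_mult)
  \<comment> \<open>At q^3 the odd part in \<open>theta_6_1_dissection\<close> becomes q^3 T^4, that
    is q times q^2 T^4, and q^2 T^4 is q T^2 evaluated at q^2.\<close>
  have T: "T = ((G oo fps_X ^ 3) oo fps_X ^ 2) + fps_X * ((fps_X * T\<^sup>2) oo fps_X ^ 2)"
  proof -
    have "T = (((G oo fps_X ^ 2) + fps_X * (theta 6 1) ^ 4) oo fps_X ^ 3)"
      unfolding T_def by (rule arg_cong[OF G])
    also have "\<dots> = ((G oo fps_X ^ 2) oo fps_X ^ 3) + fps_X ^ 3 * T ^ 4"
      by (simp add: fps_compose_add_distrib compose_X_mult compose_X_power X_compose_X T_def)
    also have "(G oo fps_X ^ 2) oo fps_X ^ 3 = (G oo fps_X ^ 3) oo fps_X ^ 2"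
      by (simp add: compose_X_compose_X)
    also have "fps_X ^ 3 * T ^ 4 = fps_X * ((fps_X * T\<^sup>2) oo fps_X ^ 2)"
    proof -
      have "T\<^sup>2 oo fps_X ^ 2 = T ^ 4"
        using fps_bit_square[of "T\<^sup>2"] by (simp flip: power_mult)
      then have "(fps_X * T\<^sup>2) oo fps_X ^ 2 = fps_X\<^sup>2 * T ^ 4"
        by (simp add: compose_X_mult X_compose_X)
      then show ?thesis
        by (simp only:) (simp add: power2_eq_square power3_eq_cube mult_ac)
    qed
    finally show ?thesis .
  qed
  have T3: "T * euler 3 = (euler 9) ^ 3"
    using arg_cong[OF theta_6_1, of "\<lambda>F. F oo fps_X ^ 3"] euler_mult[of 3 1] euler_mult[of 3 3]
    by (simp add: T_def compose_X_mult compose_X_power)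
  have 369: "euler 3 * euler 9 * euler 18 = euler 6 * T"
  proof -
    have "euler 1 * euler 3 * euler 6 = euler 2 * theta 6 1"
      using theta_6_1 by (simp add: euler_values power2_eq_square power3_eq_cube algebra_simps del: One_nat_def)
    from arg_cong[OF this, of "\<lambda>F. F oo fps_X ^ 3"] show ?thesis
      using euler_mult[of 3 1] euler_mult[of 3 3] euler_mult[of 3 6] euler_mult[of 3 2]
      by (simp add: compose_X_mult T_def del: One_nat_def)
  qed
  have "regular_gf * (euler 1) ^ 4 * euler 18 = (regular_gf * euler 1) * (euler 1) ^ 3 * euler 18"
    by (simp only: power4_eq_xxxx power3_eq_cube mult_ac)
  also have "\<dots> = euler 3 * euler 9 * euler 18 + fps_X * (euler 9) ^ 4 * euler 18"
    by (simp only: regular_gf_euler euler_cube_dissection)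
      (simp add: algebra_simps power4_eq_xxxx power3_eq_cube)
  finally have *: "regular_gf * (euler 1) ^ 4 * euler 18 = euler 6 * T + fps_X * (euler 9) ^ 4 * euler 18"
    by (simp only: 369)
  have L: "regular_gf * (euler 1) ^ 4 * euler 18 =
    ((E * euler 2 * euler 9) oo fps_X ^ 2) + fps_X * ((regular_odd_gf * euler 2 * euler 9) oo fps_X ^ 2)"
    by (subst E) (simp add: compose_X_mult e2 algebra_simps del: One_nat_def)
  have R: "euler 6 * T + fps_X * (euler 9) ^ 4 * euler 18 =
    ((euler 3 * (G oo fps_X ^ 3)) oo fps_X ^ 2) + fps_X * ((fps_X * euler 3 * T\<^sup>2 + euler 18 * euler 9) oo fps_X ^ 2)"
    by (subst T) (simp add: compose_X_mult fps_compose_add_distrib e2 algebra_simps)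
  have "regular_odd_gf * euler 2 * euler 9 = fps_X * euler 3 * T\<^sup>2 + euler 18 * euler 9"
    using * unfolding L R by (rule odd_part_unique)
  \<comment> \<open>The factor f_3 turns T into f_9^3; the cube dissection, read backwards, then
    collapses the sum to f_9^3 f_1^3.\<close>
  then have "regular_odd_gf * euler 2 * euler 9 * euler 3 = fps_X * (T * euler 3)\<^sup>2 + euler 18 * euler 9 * euler 3"
    by (simp add: algebra_simps power2_eq_square)
  also have "\<dots> = (euler 9) ^ 3 * (euler 3 + fps_X * (euler 9) ^ 3)"
    using euler_double[of 9] by (simp only: T3) (simp add: algebra_simps power2_eq_square power3_eq_cube)
  also have "\<dots> = (euler 9) ^ 3 * (euler 1) ^ 3" by (simp only: euler_cube_dissection)
  finally have "regular_odd_gf * euler 3 * ((euler 1)\<^sup>2 * euler 9) = (euler 9)\<^sup>2 * euler 1 * ((euler 1)\<^sup>2 * euler 9)"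
    by (simp only: euler_values power2_eq_square power3_eq_cube mult_ac)
  then show ?thesis using euler_nonzero by (simp only: mult_cancel_right) simp
qed

subsection \<open>Factorisations counted by the odd part\<close>

text \<open>The patterns have products 2, 5 and 8 modulo 9, the residues that are 2 modulo 3. Pairs
  of negative factors are included; they match the negative quadrant of
  \<open>same_sign\<close>.\<close>

definition factor_pairs :: "(int \<times> int) set" where
  "factor_pairs = {(u, v). 0 < u * v \<and> (u mod 9, v mod 9) \<in> {(2, 1), (5, 1), (4, 2)}}"

definition factor_gf :: "bit fps" where
  "factor_gf = gf factor_pairs (\<lambda>(u, v). u * v)"

lemma admissible_positive_products:
  "admissible {(u, v). 0 < u * v} (\<lambda>(u, v). u * v :: int)"
proof (rule admissible_pairI)
  fix u v :: int assume "(u, v) \<in> {(u, v). 0 < u * v}"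
  then have *: "u * v = \<bar>u\<bar> * \<bar>v\<bar>" "0 < \<bar>u\<bar>" "0 < \<bar>v\<bar>" by (auto simp flip: abs_mult)
  show "\<bar>u\<bar> \<le> u * v" "\<bar>v\<bar> \<le> u * v"
    using mult_left_mono[of 1 "\<bar>v\<bar>" "\<bar>u\<bar>"] mult_right_mono[of 1 "\<bar>u\<bar>" "\<bar>v\<bar>"] * by auto
qed

text \<open>Completing the product: (9 m + s) (9 n + r) is 9 times the exponent of the Kronecker sum
  plus r s. As r and s lie strictly between 0 and 9, the signs of m and n decide those of the
  factors.\<close>

lemma kronecker_sum_factor_pairs:
  assumes "0 < r" "0 < s" "r + s < 9"
  shows "fps_X ^ nat (r * s) * (kronecker_sum 9 r s oo fps_X ^ 9) =
         gf {(u, v). 0 < u * v \<and> u mod 9 = s \<and> v mod 9 = r} (\<lambda>(u, v). u * v)"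
proof -
  let ?w = "\<lambda>(m, n). 9 * m * n + r * m + s * n"
  let ?Z = "{(u, v). 0 < u * v \<and> u mod 9 = s \<and> v mod 9 = r}"
  have adm: "admissible same_sign ?w" using assms by (intro admissible_kronecker_sum) auto
  have "admissible same_sign (\<lambda>i. int 9 * ?w i)"
    using adm by (rule admissible_scale) simp
  then have "fps_X ^ nat (r * s) * (kronecker_sum 9 r s oo fps_X ^ 9) = gf same_sign (\<lambda>i. int (nat (r * s)) + int 9 * ?w i)"
    by (simp add: kronecker_sum_def gf_compose gf_shift)
  also have "\<dots> = gf ?Z (\<lambda>(u, v). u * v)"
  proof (rule gf_bij)
    show "bij_betw (\<lambda>(m, n). (9 * m + s, 9 * n + r)) same_sign ?Z"
    proof (rule bij_betw_byWitness[where f' = "\<lambda>(u, v). (u div 9, v div 9)"])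
      show "(\<lambda>(m, n). (9 * m + s, 9 * n + r)) ` same_sign \<subseteq> ?Z"
      proof clarify
        fix m n assume "(m, n) \<in> same_sign"
        then consider "0 \<le> m" "0 \<le> n" | "m < 0" "n < 0" by (auto simp: same_sign_def)
        then have "0 < 9 * m + s \<and> 0 < 9 * n + r \<or> 9 * m + s < 0 \<and> 9 * n + r < 0"
          using assms by cases linarith+
        then show "0 < (9 * m + s) * (9 * n + r) \<and> (9 * m + s) mod 9 = s \<and> (9 * n + r) mod 9 = r"
          using assms by (simp add: zero_less_mult_iff)
      qed
      show "(\<lambda>(u, v). (u div 9, v div 9)) ` ?Z \<subseteq> same_sign"
        by (auto simp: same_sign_def zero_less_mult_iff)
    qed (use assms in auto)
    show "(case (case i of (m, n) \<Rightarrow> (9 * m + s, 9 * n + r)) of (u, v) \<Rightarrow> u * v) = int (nat (r * s)) + int 9 * ?w i" for i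
      using assms by (cases i) (simp add: algebra_simps)
  qed
  finally show ?thesis .
qed

lemma factor_gf_eq:
  "factor_gf = fps_X ^ 2 * (kronecker_sum 9 1 2 oo fps_X ^ 9) + fps_X ^ 5 * (kronecker_sum 9 1 5 oo fps_X ^ 9) +
     fps_X ^ 8 * (kronecker_sum 9 2 4 oo fps_X ^ 9)"
proof -
  let ?w = "\<lambda>(u, v). u * v :: int"
  let ?Z = "\<lambda>s r. {(u, v). 0 < u * v \<and> u mod 9 = s \<and> v mod 9 = r} :: (int \<times> int) set"
  have adm: "admissible (?Z s r) ?w" for s r
    by (rule admissible_subset[OF admissible_positive_products]) auto
  have "factor_pairs = (?Z 2 1 \<union> ?Z 5 1) \<union> ?Z 4 2" by (auto simp: factor_pairs_def)
  moreover have "gf ((?Z 2 1 \<union> ?Z 5 1) \<union> ?Z 4 2) ?w = gf (?Z 2 1 \<union> ?Z 5 1) ?w + gf (?Z 4 2) ?w"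
    by (rule gf_Un_disjoint) (auto intro!: adm admissible_Un)
  moreover have "gf (?Z 2 1 \<union> ?Z 5 1) ?w = gf (?Z 2 1) ?w + gf (?Z 5 1) ?w"
    by (rule gf_Un_disjoint) (auto intro!: adm)
  ultimately show ?thesis
    using kronecker_sum_factor_pairs[of 1 2] kronecker_sum_factor_pairs[of 1 5] kronecker_sum_factor_pairs[of 2 4]
    by (simp add: factor_gf_def)
qed

text \<open>After multiplication by all three theta functions at q^9, each Kronecker sum absorbs two
  of them into a common Euler product. The third ones, with their powers of q, add up to q^2 times
  the 3-dissection of f_3.\<close>

lemma factor_gf_euler: "factor_gf * euler 9 = fps_X\<^sup>2 * (euler 27)\<^sup>2 * euler 3"
proof -
  let ?t = "\<lambda>r. theta 9 r oo fps_X ^ 9" and ?k = "\<lambda>r s. kronecker_sum 9 r s oo fps_X ^ 9"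
  have e: "euler 9 oo fps_X ^ 9 = euler 81" "euler 3 oo fps_X ^ 9 = euler 27" "euler 1 oo fps_X ^ 9 = euler 9"
    using euler_mult[of 9 9] euler_mult[of 9 3] euler_mult[of 9 1] by simp_all
  have k: "?t r * ?t s * ?k r s = (euler 81) ^ 3 * euler 27" if "r \<in> {1, 2}" "0 < s" "r + s \<in> {3, 6}" for r s
    using arg_cong[OF kronecker_sum_9[OF that], of "\<lambda>F. F oo fps_X ^ 9"]
    by (simp add: compose_X_mult compose_X_power e)
  have "theta 9 5 = theta 9 4" using theta_reflect[of 9 4] by simp
  then have k12: "?t 1 * ?t 2 * ?k 1 2 = (euler 81) ^ 3 * euler 27"
    and k14: "?t 1 * ?t 4 * ?k 1 5 = (euler 81) ^ 3 * euler 27"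
    and k24: "?t 2 * ?t 4 * ?k 2 4 = (euler 81) ^ 3 * euler 27"
    using k[of 1 2] k[of 1 5] k[of 2 4] by simp_all
  have t: "?t 1 * ?t 2 * ?t 4 * euler 27 = euler 9 * (euler 81) ^ 3"
    using arg_cong[OF theta_9_product, of "\<lambda>F. F oo fps_X ^ 9"]
    by (simp add: compose_X_mult compose_X_power e del: One_nat_def)
  have "?t 1 * ?t 2 * ?t 4 * factor_gf =
      fps_X ^ 2 * (?t 1 * ?t 2 * ?k 1 2) * ?t 4 + fps_X ^ 5 * (?t 1 * ?t 4 * ?k 1 5) * ?t 2 +
      fps_X ^ 8 * (?t 2 * ?t 4 * ?k 2 4) * ?t 1"
    unfolding factor_gf_eq by (simp only: distrib_left distrib_right mult_ac)
  also have "\<dots> = (euler 81) ^ 3 * euler 27 * (fps_X\<^sup>2 * (?t 4 + fps_X ^ 3 * ?t 2 + fps_X ^ 6 * ?t 1))"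
    unfolding k12 k14 k24 by (simp add: distrib_left distrib_right mult_ac flip: power_add)
  also have "\<dots> = (euler 81) ^ 3 * euler 27 * (fps_X\<^sup>2 * euler 3)"
    by (simp only: euler_3_dissection[symmetric])
  finally have *: "?t 1 * ?t 2 * ?t 4 * factor_gf = (euler 81) ^ 3 * euler 27 * (fps_X\<^sup>2 * euler 3)" .
  have "?t 1 * ?t 2 * ?t 4 * euler 27 * factor_gf = euler 27 * (?t 1 * ?t 2 * ?t 4 * factor_gf)"
    by (simp only: mult_ac)
  also have "\<dots> = (euler 81) ^ 3 * (fps_X\<^sup>2 * (euler 27)\<^sup>2 * euler 3)"
    unfolding * by (simp only: mult_ac power2_eq_square)
  finally have "(euler 81) ^ 3 * (factor_gf * euler 9) = (euler 81) ^ 3 * (fps_X\<^sup>2 * (euler 27)\<^sup>2 * euler 3)"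
    unfolding t by (simp only: mult_ac)
  then show ?thesis using euler_nonzero[of 81] by (simp only: mult_cancel_left) simp
qed

lemma factor_gf_regular: "factor_gf = fps_X\<^sup>2 * (regular_odd_gf oo fps_X ^ 3)"
proof -
  have "(regular_odd_gf oo fps_X ^ 3) * euler 9 = (euler 27)\<^sup>2 * euler 3"
    using arg_cong[OF regular_odd_gf_euler, of "\<lambda>F. F oo fps_X ^ 3"] euler_mult[of 3 1] euler_mult[of 3 3] euler_mult[of 3 9]
    by (simp add: compose_X_mult compose_X_power)
  then have "fps_X\<^sup>2 * (regular_odd_gf oo fps_X ^ 3) * euler 9 = factor_gf * euler 9"
    unfolding factor_gf_euler by (simp only: mult_ac)
  then show ?thesis using euler_nonzero[of 9] by (simp only: mult_cancel_right) simp
qed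

lemma regular_odd_parity:
  "of_nat (num_regular_partitions 9 (2 * n + 1)) = fps_nth factor_gf (3 * n + 2)"
  by (simp add: factor_gf_regular fps_X_power_mult_nth fps_nth_compose_X_power regular_odd_gf_def)

subsection \<open>The action of primes congruent to 1 or -1 modulo 9\<close>

definition factorisations :: "nat \<Rightarrow> (int \<times> int) set" where
  "factorisations N = {(u, v). (u, v) \<in> factor_pairs \<and> u * v = int N}"

lemma fps_nth_factor_gf: "fps_nth factor_gf N = (\<Sum>x\<in>factorisations N. 1)"
  unfolding factor_gf_def gf_nth factorisations_def by (rule sum.cong) auto

lemma finite_factorisations: "finite (factorisations N)"
proof (rule finite_subset)
  have "admissible factor_pairs (\<lambda>(u, v). u * v)"
    by (rule admissible_subset[OF admissible_positive_products]) (auto simp: factor_pairs_def)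
  then show "finite {i \<in> factor_pairs. (case i of (u, v) \<Rightarrow> u * v) = int N}"
    by (rule admissible_finite)
qed (auto simp: factorisations_def)

lemma factor_pairs_scale:
  assumes "x mod 9 = u mod 9" "y mod 9 = v mod 9" "0 < x * y" "0 < u * v"
  shows "(x, y) \<in> factor_pairs \<longleftrightarrow> (u, v) \<in> factor_pairs"
  using assms by (simp add: factor_pairs_def)

text \<open>A weight 1 Hecke relation whose eigenvalue at p is 0 modulo 2.\<close>

lemma factor_gf_prime:
  assumes p: "prime p" "p mod 9 \<in> {1, 8}" and N: "0 < N"
  shows "fps_nth factor_gf (p * N) = (if p dvd N then fps_nth factor_gf (N div p) else 0)"
proof -
  define \<pi> where "\<pi> = (if p mod 9 = 1 then int p else - int p)"
  have "\<pi> mod 9 = 1"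
    using p(2) unfolding \<pi>_def by (auto simp: zmod_int[symmetric]) presburger+
  then have pm: "(\<pi> ^ k) mod 9 = 1" for k by (metis mod_mod_trivial one_mod_numeral power_mod power_one)
  have scale: "(u * \<pi> ^ k) mod 9 = u mod 9" for u k
    using pm[of k] mod_mult_right_eq[of u "\<pi> ^ k" 9] by simp
  have \<pi>: "prime_elem \<pi>" "\<bar>\<pi>\<bar> = int p" "\<pi> * \<pi> = int p * int p" "\<pi> \<noteq> 0"
    using p(1) by (auto simp: \<pi>_def prime_elem_int_abs_iff[symmetric] prime_gt_0_nat)
  have dvd: "\<pi> dvd x \<longleftrightarrow> int p dvd x" for x by (simp add: \<pi>_def)
  let ?F = "factorisations (p * N)"
  let ?R = "{(u, v) \<in> ?F. \<not> (\<pi> dvd u \<and> \<pi> dvd v)}" and ?B = "{(u, v) \<in> ?F. \<pi> dvd u \<and> \<pi> dvd v}"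
  have "int (p * N) \<noteq> 0" "\<not> is_unit \<pi>"
    using N p(1) \<pi>(1) by (auto simp: prime_gt_0_nat)
  then obtain w where w: "int (p * N) = \<pi> ^ multiplicity \<pi> (int (p * N)) * w" "\<not> \<pi> dvd w"
    by (rule multiplicity_decompose')
  define e where "e = multiplicity \<pi> (int (p * N))"
  have e: "int (p * N) = \<pi> ^ e * w" using w(1) by (simp add: e_def)
  have "\<pi> dvd int (p * N)" by (simp add: dvd)
  \<comment> \<open>Hence in a pair of \<open>?R\<close> exactly one factor is divisible by \<pi>,
    and moving the power of \<pi> has no fixed point.\<close>
  then have "e \<noteq> 0" using w(2) e by (metis mult_1 power_0)
  then have \<pi>e: "\<pi> dvd \<pi> ^ e" by simp
  \<comment> \<open>If \<pi> does not divide u, the whole power lies in v, and the cofactor divides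
    w and so is not divisible by \<pi>.\<close>
  have split: "\<exists>y. y * \<pi> ^ e = v \<and> \<not> \<pi> dvd y" if uv: "u * v = \<pi> ^ e * w" and "\<not> \<pi> dvd u" for u v
  proof -
    have "coprime (\<pi> ^ e) u" using that \<pi>(1) by (simp add: prime_elem_imp_coprime)
    then have "\<pi> ^ e dvd v" using uv by (metis coprime_dvd_mult_right_iff dvd_triv_left)
    then obtain y where y: "v = \<pi> ^ e * y" by blast
    then have "u * y = w" using uv \<pi>(4) by simp
    then show ?thesis using y w(2) by (metis dvd_mult mult.commute)
  qed
  define h where "h = (\<lambda>(u, v). if \<pi> dvd u then (u div \<pi> ^ e, v * \<pi> ^ e) else (u * \<pi> ^ e, v div \<pi> ^ e))"
  have R: "(\<Sum>x\<in>?R. 1) = (0 :: bit)"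
  proof (rule sum_involution_eq_0[where h = h])
    fix x assume "x \<in> ?R"
    then obtain u v where x: "x = (u, v)" "(u, v) \<in> factor_pairs" "u * v = \<pi> ^ e * w" "\<not> (\<pi> dvd u \<and> \<pi> dvd v)"
      by (auto simp: factorisations_def e simp del: of_nat_mult)
    have pos: "0 < u * v" using x(2) by (simp add: factor_pairs_def)
    have "h x \<in> ?R \<and> h (h x) = x \<and> h x \<noteq> x"
    proof (cases "\<pi> dvd u")
      case True
      then obtain y where y: "y * \<pi> ^ e = u" "\<not> \<pi> dvd y" using split[of v u] x by (auto simp: mult.commute)
      have hx: "h x = (y, v * \<pi> ^ e)" using True y \<pi>(4) by (auto simp: h_def x(1))
      have prod: "y * (v * \<pi> ^ e) = u * v" using y by (simp add: mult_ac)
      moreover have "y mod 9 = u mod 9" using scale[of y e] y(1) by simp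
      then have "(y, v * \<pi> ^ e) \<in> factor_pairs \<longleftrightarrow> (u, v) \<in> factor_pairs"
        by (rule factor_pairs_scale[OF _ scale]) (simp_all only: prod pos)
      moreover have "h (y, v * \<pi> ^ e) = (u, v)" using y \<pi>(4) by (simp add: h_def)
      ultimately show ?thesis
        unfolding hx using x y True by (auto simp: factorisations_def e simp del: of_nat_mult)
    next
      case False
      then obtain y where y: "y * \<pi> ^ e = v" "\<not> \<pi> dvd y" using split[of u v] x by auto
      have hx: "h x = (u * \<pi> ^ e, y)" using False y \<pi>(4) by (auto simp: h_def x(1))
      have prod: "u * \<pi> ^ e * y = u * v" using y by (simp add: mult_ac)
      moreover have "y mod 9 = v mod 9" using scale[of y e] y(1) by simp
      then have "(u * \<pi> ^ e, y) \<in> factor_pairs \<longleftrightarrow> (u, v) \<in> factor_pairs"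
        by (rule factor_pairs_scale[OF scale]) (simp_all only: prod pos)
      moreover have "h (u * \<pi> ^ e, y) = (u, v)" using y \<pi>(4) \<pi>e by (simp add: h_def)
      moreover have "u * \<pi> ^ e \<noteq> u" using False \<pi>e by (metis dvd_mult)
      ultimately show ?thesis
        unfolding hx using x y False \<pi>e by (auto simp: factorisations_def e simp del: of_nat_mult)
    qed
    then show "h x \<in> ?R" "h (h x) = x" "h x \<noteq> x" by auto
  qed simp
  \<comment> \<open>Dividing both factors by \<pi> divides the product by p^2, which leads from p N
    to N / p. If p does not divide N, then p^2 does not divide p N and \<open>?B\<close> is
    empty.\<close>
  have B: "(\<Sum>x\<in>?B. 1) = (if p dvd N then fps_nth factor_gf (N div p) else 0)"
  proof (cases "p dvd N")
    case True
    then obtain M where M: "N = p * M" by blast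
    have "bij_betw (\<lambda>(u, v). (\<pi> * u, \<pi> * v)) (factorisations M) ?B"
    proof (rule bij_betw_byWitness[where f' = "\<lambda>(u, v). (u div \<pi>, v div \<pi>)"])
      show "(\<lambda>(u, v). (\<pi> * u, \<pi> * v)) ` factorisations M \<subseteq> ?B"
      proof clarify
        fix u v assume "(u, v) \<in> factorisations M"
        then have uv: "(u, v) \<in> factor_pairs" "u * v = int M" by (auto simp: factorisations_def)
        have prod: "(\<pi> * u) * (\<pi> * v) = int (p * N)" using \<pi>(3) uv(2) by (simp add: M algebra_simps)
        have "(\<pi> * u, \<pi> * v) \<in> factor_pairs \<longleftrightarrow> (u, v) \<in> factor_pairs"
          using uv N p(1) scale[of u 1] scale[of v 1] 
          by (intro factor_pairs_scale) (auto simp: prod mult.commute factor_pairs_def simp del: of_nat_mult intro: prime_gt_0_nat)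
        then show "(\<pi> * u, \<pi> * v) \<in> ?F \<and> \<pi> dvd \<pi> * u \<and> \<pi> dvd \<pi> * v"
          using uv(1) prod by (simp add: factorisations_def)
      qed
      show "(\<lambda>(u, v). (u div \<pi>, v div \<pi>)) ` ?B \<subseteq> factorisations M"
      proof clarify
        fix x y assume xy: "(x, y) \<in> ?F" "\<pi> dvd x" "\<pi> dvd y"
        then obtain u v where uv: "x = \<pi> * u" "y = \<pi> * v" by (auto elim!: dvdE)
        have "(\<pi> * \<pi>) * (u * v) = (\<pi> * u) * (\<pi> * v)" by (simp only: mult_ac)
        also have "\<dots> = int (p * N)" using xy(1) by (simp add: factorisations_def uv del: of_nat_mult)
        also have "\<dots> = (\<pi> * \<pi>) * int M" by (simp add: M \<pi>(3))
        finally have "(\<pi> * \<pi>) * (u * v) = (\<pi> * \<pi>) * int M" .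
        then have prod: "u * v = int M" using \<pi>(4) by simp
        have "(\<pi> * u, \<pi> * v) \<in> factor_pairs \<longleftrightarrow> (u, v) \<in> factor_pairs"
          using xy(1) N scale[of u 1] scale[of v 1] M
          by (intro factor_pairs_scale) (auto simp: prod mult.commute factor_pairs_def factorisations_def uv intro!: gr0I)
        then show "(x div \<pi>, y div \<pi>) \<in> factorisations M"
          using xy(1) prod \<pi>(4) by (simp add: factorisations_def uv)
      qed
    qed (use \<pi>(4) in auto)
    then have "(\<Sum>x\<in>?B. 1) = (\<Sum>x\<in>factorisations M. (1 :: bit))"
      by (rule sum.reindex_bij_betw[where g = "\<lambda>_. 1", symmetric])
    then show ?thesis using p(1) by (simp only: fps_nth_factor_gf M) (simp add: prime_gt_0_nat)
  next
    case False
    have "?B = {}"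
    proof (rule ccontr)
      assume "?B \<noteq> {}"
      then obtain u v where uv: "u * v = int (p * N)" "int p dvd u" "int p dvd v"
        by (auto simp: factorisations_def dvd)
      then have "int p * int p dvd int p * int N" by (metis mult_dvd_mono of_nat_mult)
      then show False using False p(1) by (simp add: prime_gt_0_nat)
    qed
    then show ?thesis using False by (simp only: sum.empty if_False)
  qed
  have "?F = ?R \<union> ?B" by auto
  moreover have "(\<Sum>x\<in>?R \<union> ?B. 1) = (\<Sum>x\<in>?R. 1) + (\<Sum>x\<in>?B. (1 :: bit))"
    by (rule sum.union_disjoint) (auto intro: finite_subset[OF _ finite_factorisations[of "p * N"]])
  ultimately have "fps_nth factor_gf (p * N) = (\<Sum>x\<in>?R. 1) + (\<Sum>x\<in>?B. 1)"
    by (simp only: fps_nth_factor_gf)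
  then show ?thesis by (simp only: R B add_0)
qed

section \<open>The congruence, by comparing coefficients through the factorisation count\<close>

theorem theorem1p2:
  fixes p \<alpha> \<beta> :: nat
  assumes "p \<in> {53, 71, 73, 89}"
    and "0 < \<alpha>" and "\<alpha> < 2 * p"
    and "[int \<alpha> = - modular_inverse (2 * int p) 3] (mod (2 * int p))"
    and "\<beta> = nat \<lfloor>2 * real p / 3\<rfloor>"
  shows "fps_cong_mod 2
           (Abs_fps (\<lambda>n. int (num_regular_partitions 9 (2 * p * n + \<alpha>))))
           (fps_X ^ \<beta> *
             fps_compose (Abs_fps (\<lambda>n. int (num_regular_partitions 9 (2 * n + 1)))) (fps_X ^ p))"
proof -
  have "coprime 3 (2 * int p)"
    using assms(1) by (auto simp: coprime_iff_gcd_eq_1 gcd_non_0_int)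
  then have "[3 * modular_inverse (2 * int p) 3 = 1] (mod (2 * int p))"
    by (rule cong_modular_inverse1)
  then have "[3 * int \<alpha> = - 1] (mod (2 * int p))"
    using cong_scalar_left[OF assms(4), of 3] cong_minus_minus_iff
    by (metis cong_trans mult_minus_right)
  then have "2 * int p dvd 3 * int \<alpha> + 1"
    by (simp add: cong_iff_dvd_diff)
  then have d: "2 * p dvd 3 * \<alpha> + 1"
    by presburger
  have \<beta>: "\<beta> = 2 * p div 3"
    using floor_divide_of_nat_eq[where 'a = real, of "2 * p" 3] assms(5) by simp
  have p: "prime p" "p mod 9 \<in> {1, 8}" using assms(1) by auto
  \<comment> \<open>The bound on \<alpha> leaves k = 1 or k = 2, and k is the remainder of 2 p
    modulo 3, which ties it to \<beta> by 3 \<beta> + k = 2 p.\<close>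
  obtain k where k: "3 * \<alpha> + 1 = 2 * p * k" using d by blast
  have "k < 3"
  proof (rule ccontr)
    assume "\<not> k < 3"
    then have "2 * p * 3 \<le> 2 * p * k" by (intro mult_left_mono) auto
    then show False using k assms(3) by linarith
  qed
  moreover have "k \<noteq> 0" using k by (intro notI) simp
  ultimately have "k = 1 \<or> k = 2" by linarith
  then have k\<beta>: "3 * \<beta> + k = 2 * p" using assms(1) k \<beta> by auto presburger+
  show ?thesis
    unfolding fps_cong_mod_def
  proof
    fix n
    let ?b = "num_regular_partitions 9"
    have "even (3 * \<alpha> + 1)" unfolding k by simp
    then have "odd \<alpha>" by simp
    then obtain a where a: "\<alpha> = 2 * a + 1" by (elim oddE)
    have "2 * p * n + \<alpha> = 2 * (p * n + a) + 1" by (simp add: a)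
    \<comment> \<open>With \<alpha> = 2 a + 1 the equation for k becomes 3 a + 2 = p k, so the
      number to be factorised is divisible by p.\<close>
    moreover have "3 * (p * n + a) + 2 = p * (3 * n + k)"
      using k by (simp add: a algebra_simps)
    ultimately have L: "(of_nat (?b (2 * p * n + \<alpha>)) :: bit) = fps_nth factor_gf (p * (3 * n + k))"
      by (simp only: regular_odd_parity)
    have parity: "[int a = int b] (mod 2) \<longleftrightarrow> (of_nat a :: bit) = of_nat b" for a b
      unfolding of_nat_bit_eq_iff cong_def by presburger
    show "[fps_nth (Abs_fps (\<lambda>n. int (?b (2 * p * n + \<alpha>)))) n =
       fps_nth (fps_X ^ \<beta> * (Abs_fps (\<lambda>n. int (?b (2 * n + 1))) oo fps_X ^ p)) n] (mod 2)"
    \<comment> \<open>The condition describes where the right-hand side can be nonzero. Since 3 n +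
      k = 3 (n - \<beta>) + 2 p, for n = \<beta> + p m the quotient of 3 n + k by p is 3 m + 2,
      which belongs to the partitions of 2 m + 1.\<close>
    proof (cases "\<beta> \<le> n \<and> p dvd n - \<beta>")
      case True
      then obtain m where m: "n = \<beta> + p * m" by (metis dvdE le_add_diff_inverse)
      have "3 * n + k = p * (3 * m + 2)" using m k\<beta> by (simp add: algebra_simps)
      then have "fps_nth factor_gf (p * (3 * n + k)) = of_nat (?b (2 * m + 1))"
        using factor_gf_prime[OF p, of "3 * n + k"] p(1) regular_odd_parity[of m]
        by (simp add: prime_gt_0_nat)
      then have "[int (?b (2 * p * n + \<alpha>)) = int (?b (2 * m + 1))] (mod 2)"
        unfolding parity L .
      then show ?thesis
        using p(1) by (simp add: m fps_X_power_mult_nth fps_nth_compose_X_power prime_gt_0_nat)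
    next
      case False
      have "\<not> p dvd 3 * n + k"
      proof
        assume "p dvd 3 * n + k"
        then obtain j where j: "3 * n + k = p * j" by blast
        have "int p * (int j - 2) = 3 * (int n - int \<beta>)"
          using arg_cong[OF j, of int] arg_cong[OF k\<beta>, of int] by (simp add: algebra_simps)
        then have "int p dvd 3 * (int n - int \<beta>)" by (metis dvd_triv_left)
        moreover have "coprime (int p) 3" using assms(1) by (auto simp: coprime_iff_gcd_eq_1 gcd_non_0_int)
        ultimately have "int p dvd int n - int \<beta>" by (simp only: coprime_dvd_mult_right_iff)
        then obtain i where i: "int n - int \<beta> = int p * i" by blast
        show False
        proof (cases "\<beta> \<le> n")
          case True
          then have "int p dvd int (n - \<beta>)" using i by (simp add: of_nat_diff)
          then show False using True False by (simp only: int_dvd_int_iff simp_thms)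
        next
          case False
          \<comment> \<open>For n < \<beta> the divisibility would force n <= \<beta> - p, but 3
            \<beta> < 2 p makes \<beta> smaller than p.\<close>
          then have "i \<le> - 1" using i
            by (smt (verit, ccfv_SIG) mult_nonneg_nonneg of_nat_0_le_iff of_nat_le_iff)
          then have "int p * i \<le> int p * (- 1)" by (intro mult_left_mono) auto
          then show False using i k\<beta> \<open>k = 1 \<or> k = 2\<close> assms(1) by auto
        qed
      qed
      then have "[int (?b (2 * p * n + \<alpha>)) = int 0] (mod 2)"
        unfolding parity L using factor_gf_prime[OF p, of "3 * n + k"] \<open>k \<noteq> 0\<close> by simp
      then show ?thesis
        using False by (auto simp: fps_X_power_mult_nth fps_nth_compose_X_power)
    qed
  qed
qed

end
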